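(* For any fixed integer $t\ge 1$, every graph $G$ with $m$ edges and $\lambda(G)>\sqrt m$ satisfies $$\#B_t(G)\ \ge\ \left(\frac{1}{t!\,2^t}-o(1)\right)m^{t/2},$$ where $o(1)\to 0$ as $m\to\infty$ (for fixed $t$, uniformly over all such $G$).
   Context: Graphs are finite and simple. $\lambda(G)$ is the largest eigenvalue of the adjacency matrix of $G$. $B_t$ (the book of size $t$) is the graph consisting of $t$ triangles sharing a common edge, and $\#B_t(G)$ is the number of copies of $B_t$ in $G$ as (not necessarily induced) subgraphs. Thus $\#B_1(G)$ is the number of triangles of $G$, and for $t\ge 2$, $\#B_t(G)=\sum_{uv\in E(G)}\binom{|N(u)\cap N(v)|}{t}$. *)

theory Defs
  imports Complex_Main "Jordan_Normal_Form.Spectral_Radius"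
begin

definition simple_graph :: "'a set \<Rightarrow> 'a set set \<Rightarrow> bool" where
  "simple_graph V E \<longleftrightarrow> finite V \<and> (\<forall>e\<in>E. e \<subseteq> V \<and> card e = 2)"

definition adjacency_matrix :: "nat \<Rightarrow> nat set set \<Rightarrow> real mat" where
  "adjacency_matrix n E = mat n n (\<lambda>(i, j). if {i, j} \<in> E then 1 else 0)"

(* The matrix is real symmetric, so its real spectrum consists of all its eigenvalues.
   For n = 0 the spectrum is empty and the value is unspecified. *)
definition graph_lambda :: "nat \<Rightarrow> nat set set \<Rightarrow> real" where
  "graph_lambda n E = Max (spectrum (adjacency_matrix n E))"

(* (W, F) is isomorphic to B_t: {u, v} is the common edge of the t triangles, and S is the set
   of their third vertices. For t = 0 (not used) infinite sets S have to be excluded. *)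
definition is_book :: "nat \<Rightarrow> 'a set \<Rightarrow> 'a set set \<Rightarrow> bool" where
  "is_book t W F \<longleftrightarrow> (\<exists>u v S. u \<noteq> v \<and> u \<notin> S \<and> v \<notin> S \<and> finite S \<and> card S = t \<and>
     W = {u, v} \<union> S \<and> F = {{u, v}} \<union> (\<lambda>w. {u, w}) ` S \<union> (\<lambda>w. {v, w}) ` S)"

(* Copies are counted as subgraphs (W, F), not as embeddings: a triangle counts once for t = 1,
   although each of its three edges can play the role of the common edge. *)
definition book_count :: "nat \<Rightarrow> 'a set \<Rightarrow> 'a set set \<Rightarrow> nat" where
  "book_count t V E = card {(W, F). W \<subseteq> V \<and> F \<subseteq> E \<and> is_book t W F}"

end

theory Submission
  imports Defs
begin

text \<open>Put $r = \sqrt m$. The theorem rests on a dichotomy for a graph with $\lambda > r$: for every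
$\epsilon > 0$ there is a $\delta > 0$ such that for every $L$, if $m$ is large, either some edge has
codegree at least $(1/2 - \epsilon) r$, or more than $L$ ordered adjacent pairs have codegree at least
$\delta r$ (lemma \<open>large_codegree_or_many_heavy_pairs\<close>). In the first case the books on that single
edge are numerous enough, because $\binom{r/2}{t}$ is about $m^{t/2} / (t!\,2^t)$. In the second case a
constant $L$ of order $\delta^{-t}$ suffices.

To prove the dichotomy, take the absolute values $y$ of an eigenvector for $\lambda$, scaled so that the
maximum $y_u = 1$; then $\lambda y \le A y$. Let $N$ be the neighbourhood of $u$ and $W$ the set of the
remaining vertices other than $u$. Expanding $\lambda \sum_N y$ and comparing it with $m$ edge by edge
shows that the edges $vw$ inside $N$ with positive \emph{excess} $y_v + y_w - 1$ must pay for every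
deviation of the graph from a complete bipartite graph with sides $N$ and $\{u\} \cup W$: the edges inside
$W$, the quantities $1 - y_z$ for the edges from $N$ to $z \in W$, and the slack $\lambda^2 - m > 0$. In particular,
if $M$ is the $y$-weighted number of nonadjacent pairs between $N$ and (essentially) $W$, then
$M \le S$, where $S > 0$ is the excess summed over ordered pairs
(lemma \<open>total_miss_le_total_excess\<close>).

Conversely, an edge inside $N$ has little excess unless its ends miss many vertices of $W$. Its excess is
at most $y_v y_w$, hence at most $\min(y_v, y_w)$. If its codegree is below $\delta r$, then each vertex of
$W$, up to $\delta r$ of them, is missed by $v$ or $w$. If its codegree is merely below
$(1/2 - \epsilon) r$, then $\lambda < \lambda (y_v + y_w)$, which is at most twice the codegree plus the
number of vertices of $W$ missed by $v$ or $w$, still forces about $2 \epsilon r$ missed vertices; there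
are at most $L$ such edges. The few vertices $x \in N$ with many neighbours in $N$ need separate care: such
an $x$ is adjacent to almost nothing in $W$, and it has at most $(1/2 - \epsilon) r$ neighbours in $N$,
since this is the codegree of $ux$. If both alternatives of the dichotomy fail, these bounds add up to
$S \le (1 - \epsilon) M$ for large $m$, contradicting $M \le S$
(lemmas \<open>excess_bound\<close> and \<open>contraction\<close>). The constant $1/2$ is needed in both places: twice the
codegree must stay below $\lambda$, and an edge at an exceptional $x$ is counted from both of its ends.\<close>

section \<open>Neighbourhoods and codegrees\<close>

definition nbrs :: "'a set set \<Rightarrow> 'a \<Rightarrow> 'a set" where
  "nbrs E v = {w. {v, w} \<in> E}"

lemma nbrs_sym: "w \<in> nbrs E v \<longleftrightarrow> v \<in> nbrs E w"
  by (simp add: nbrs_def insert_commute)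

lemma nbrs_subset:
  assumes "simple_graph V E"
  shows "nbrs E v \<subseteq> V"
  using assms by (auto simp: nbrs_def simple_graph_def)

lemma nbrs_irrefl:
  assumes "simple_graph V E"
  shows "v \<notin> nbrs E v"
  using assms by (auto simp: nbrs_def simple_graph_def)

lemma finite_nbrs:
  assumes "simple_graph V E"
  shows "finite (nbrs E v)"
  using finite_subset[OF nbrs_subset[OF assms]] assms by (simp add: simple_graph_def)

lemma sum_nbrs_swap:
  assumes "finite P" "finite Q"
  shows "(\<Sum>v\<in>P. \<Sum>w\<in>nbrs E v \<inter> Q. f v w) = (\<Sum>w\<in>Q. \<Sum>v\<in>nbrs E w \<inter> P. f v w)"
proof -
  have "(\<Sum>v\<in>P. \<Sum>w\<in>nbrs E v \<inter> Q. f v w) = (\<Sum>v\<in>P. \<Sum>w | w \<in> Q \<and> w \<in> nbrs E v. f v w)"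
    by (intro sum.cong refl) auto
  also have "\<dots> = (\<Sum>w\<in>Q. \<Sum>v | v \<in> P \<and> w \<in> nbrs E v. f v w)"
    by (rule sum.swap_restrict[OF assms])
  also have "\<dots> = (\<Sum>w\<in>Q. \<Sum>v\<in>nbrs E w \<inter> P. f v w)"
    by (intro sum.cong refl) (auto simp: nbrs_sym)
  finally show ?thesis .
qed

lemma handshake:
  assumes "simple_graph V E"
  shows "(\<Sum>v\<in>V. card (nbrs E v)) = 2 * card E"
proof -
  have fV: "finite V" and E: "\<And>e. e \<in> E \<Longrightarrow> e \<subseteq> V \<and> card e = 2"
    using assms by (auto simp: simple_graph_def)
  have fE: "finite E"
    using fV E by (auto intro: finite_subset[of E "Pow V"])
  have "(\<Sum>v\<in>V. card (nbrs E v)) = (\<Sum>v\<in>V. card {e \<in> E. v \<in> e})"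
  proof (intro sum.cong refl)
    fix v assume "v \<in> V"
    have "bij_betw (\<lambda>w. {v, w}) (nbrs E v) {e \<in> E. v \<in> e}"
    proof (rule bij_betwI')
      fix w w' show "({v, w} = {v, w'}) = (w = w')" by (auto simp: doubleton_eq_iff)
    next
      fix w assume "w \<in> nbrs E v" then show "{v, w} \<in> {e \<in> E. v \<in> e}" by (auto simp: nbrs_def)
    next
      fix e assume e: "e \<in> {e \<in> E. v \<in> e}"
      then obtain x z where xz: "e = {x, z}" using E[of e] by (auto simp: card_2_iff)
      show "\<exists>w\<in>nbrs E v. e = {v, w}"
        using e xz by (auto simp: nbrs_def insert_commute)
    qed
    then show "card (nbrs E v) = card {e \<in> E. v \<in> e}" by (rule bij_betw_same_card)
  qed
  also have "\<dots> = (\<Sum>e\<in>E. card {v \<in> V. v \<in> e})"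
    using sum.swap_restrict[OF fV fE, of "\<lambda>_ _. 1::nat" "\<lambda>v e. v \<in> e"] by simp
  also have "\<dots> = (\<Sum>e\<in>E. 2)"
  proof (intro sum.cong refl)
    fix e assume "e \<in> E"
    then have "{v \<in> V. v \<in> e} = e" using E by auto
    then show "card {v \<in> V. v \<in> e} = 2" using E \<open>e \<in> E\<close> by simp
  qed
  finally show ?thesis by simp
qed

definition codegree :: "'a set set \<Rightarrow> 'a \<Rightarrow> 'a \<Rightarrow> nat" where
  "codegree E v w = card (nbrs E v \<inter> nbrs E w)"

definition heavy_pairs :: "'a set set \<Rightarrow> real \<Rightarrow> ('a \<times> 'a) set" where
  "heavy_pairs E d = {(v, w). {v, w} \<in> E \<and> d \<le> codegree E v w}"

lemma finite_heavy_pairs: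
  assumes "simple_graph V E"
  shows "finite (heavy_pairs E d)"
proof (rule finite_subset)
  show "heavy_pairs E d \<subseteq> V \<times> V"
    using assms by (auto simp: heavy_pairs_def simple_graph_def)
  show "finite (V \<times> V)" using assms by (simp add: simple_graph_def)
qed

section \<open>Nonnegative subeigenvectors and the excess of edges\<close>

text \<open>The inequality \<open>sub\<close> is what remains of the eigenvalue equation when an eigenvector is replaced by its
absolute values. It takes the place of a Perron eigenvector.\<close>

locale subeigenvector =
  fixes V :: "'a set" and E :: "'a set set" and y :: "'a \<Rightarrow> real" and lam :: real and u :: 'a
  assumes graph: "simple_graph V E"
    and u_in: "u \<in> V" and y_u: "y u = 1"
    and y_nonneg: "\<And>v. v \<in> V \<Longrightarrow> 0 \<le> y v" and y_le: "\<And>v. v \<in> V \<Longrightarrow> y v \<le> 1"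
    and sub: "\<And>v. v \<in> V \<Longrightarrow> lam * y v \<le> sum y (nbrs E v)"
    and lam_gt: "sqrt (card E) < lam"
begin

definition "N = nbrs E u"
definition "W = V - insert u N"
definition "r = sqrt (card E)"
definition "massN v = sum y (nbrs E v \<inter> N)"
definition "dN v = real (card (nbrs E v \<inter> N))"
definition "dW v = real (card (nbrs E v \<inter> W))"

text \<open>When $\lambda \sum_N y$ is compared with the number of edges, an edge inside \<open>N\<close> contributes
$y_v + y_w$ on one side and $1$ on the other. The sum below runs over ordered pairs, so every edge
occurs in it twice.\<close>

definition "excess v w = max 0 (y v + y w - 1)"
definition "total_excess = (\<Sum>v\<in>N. \<Sum>w\<in>nbrs E v \<inter> N. excess v w)"

text \<open>\<open>Wmain\<close> together with \<open>u\<close> plays the part of the second side of the bipartite graph. The number of its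
elements is controlled by the number of edges, and the rest of \<open>W\<close> carries a negligible part \<open>light\<close>
of the weight.\<close>

definition "Wmain = {z \<in> W. lam / 2 \<le> dN z}"
definition "missing v = real (card (Wmain - nbrs E v))"
definition "total_miss = (\<Sum>v\<in>N. y v * missing v)"
definition "light = sum y (W - Wmain)"

lemma finite_V[simp]: "finite V" using graph by (simp add: simple_graph_def)
lemma NV: "N \<subseteq> V" unfolding N_def by (rule nbrs_subset[OF graph])
lemma WV: "W \<subseteq> V" unfolding W_def by auto
lemma WmainW: "Wmain \<subseteq> W" unfolding Wmain_def by auto
lemma finite_N[simp]: "finite N" using finite_subset[OF NV finite_V] .
lemma finite_W[simp]: "finite W" using finite_subset[OF WV finite_V] .
lemma finite_Wmain[simp]: "finite Wmain" using finite_subset[OF WmainW finite_W] .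
lemma finite_nb[simp]: "finite (nbrs E v)" by (rule finite_nbrs[OF graph])
lemma u_notin: "u \<notin> N" unfolding N_def by (rule nbrs_irrefl[OF graph])

lemma r_nonneg: "0 \<le> r" by (simp add: r_def)
lemma lam_pos: "0 < lam" using lam_gt r_nonneg unfolding r_def by linarith
lemma r_lam: "r < lam" using lam_gt by (simp add: r_def)
lemma r_sq: "r\<^sup>2 = real (card E)" by (simp add: r_def)
lemma lam_sq: "real (card E) < lam\<^sup>2"
  using r_lam r_nonneg r_sq by (metis power_strict_mono zero_less_numeral)

lemma nbrs_split:
  assumes "v \<in> V"
  shows "sum f (nbrs E v) = (if v \<in> N then f u else 0) + sum f (nbrs E v \<inter> N) + sum f (nbrs E v \<inter> W)"
proof -
  have "nbrs E v = (nbrs E v \<inter> {u}) \<union> ((nbrs E v \<inter> N) \<union> (nbrs E v \<inter> W))"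
    using nbrs_subset[OF graph, of v] by (auto simp: W_def)
  then have "sum f (nbrs E v) = sum f ((nbrs E v \<inter> {u}) \<union> ((nbrs E v \<inter> N) \<union> (nbrs E v \<inter> W)))"
    by simp
  also have "\<dots> = sum f (nbrs E v \<inter> {u}) + sum f ((nbrs E v \<inter> N) \<union> (nbrs E v \<inter> W))"
    by (rule sum.union_disjoint) (use u_notin in \<open>auto simp: W_def\<close>)
  also have "sum f ((nbrs E v \<inter> N) \<union> (nbrs E v \<inter> W)) = sum f (nbrs E v \<inter> N) + sum f (nbrs E v \<inter> W)"
    by (rule sum.union_disjoint) (auto simp: W_def)
  also have "sum f (nbrs E v \<inter> {u}) = (if v \<in> N then f u else 0)"
  proof (cases "v \<in> N")
    case True
    then have "nbrs E v \<inter> {u} = {u}" by (auto simp: N_def nbrs_sym)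
    then show ?thesis using True by simp
  next
    case False
    then have "nbrs E v \<inter> {u} = {}" by (auto simp: N_def nbrs_sym)
    then show ?thesis using False by simp
  qed
  finally show ?thesis by (simp add: add.assoc)
qed

lemma excess_le_prod:
  assumes "v \<in> V" "w \<in> V"
  shows "excess v w \<le> y v * y w"
proof -
  have "0 \<le> (1 - y v) * (1 - y w)"
    using y_le[OF assms(1)] y_le[OF assms(2)] by simp
  then have "y v + y w - 1 \<le> y v * y w" by (simp add: algebra_simps)
  moreover have "0 \<le> y v * y w"
    using y_nonneg[OF assms(1)] y_nonneg[OF assms(2)] by simp
  ultimately show ?thesis by (simp add: excess_def)
qed

lemma excess_le:
  assumes "v \<in> V" "w \<in> V"
  shows "excess v w \<le> y v" "excess v w \<le> y w"
  using y_le[OF assms(1)] y_le[OF assms(2)] y_nonneg[OF assms(1)] y_nonneg[OF assms(2)]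
  by (simp_all add: excess_def)

lemma excess_nonneg: "0 \<le> excess v w" by (simp add: excess_def)

text \<open>Both sides of $\lambda \sum_N y \le \sum_{v \in N} \sum_{z \sim v} y_z$ and $m$ are expanded over the
kinds of edges. An edge at \<open>u\<close> counts $1$ in both; an edge inside \<open>N\<close> counts $y_v + y_w$ against $1$; an
edge from \<open>N\<close> to $z \in W$ counts $y_z$ against $1$; an edge inside \<open>W\<close> counts $0$ against $1$.\<close>

lemma edge_by_edge_comparison:
  "(\<Sum>z\<in>W. dN z * (1 - y z)) + (\<Sum>z\<in>W. dW z) / 2 + lam * (sum y N - lam) + (lam\<^sup>2 - card E)
    \<le> total_excess / 2"
proof -
  have a: "lam * sum y N \<le> card N + (\<Sum>v\<in>N. massN v) + (\<Sum>z\<in>W. dN z * y z)"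
  proof -
    have "lam * sum y N = (\<Sum>v\<in>N. lam * y v)" by (simp add: sum_distrib_left)
    also have "\<dots> \<le> (\<Sum>v\<in>N. sum y (nbrs E v))" using sub NV by (intro sum_mono) auto
    also have "\<dots> = (\<Sum>v\<in>N. 1 + massN v + sum y (nbrs E v \<inter> W))"
      using NV by (intro sum.cong refl) (auto simp: nbrs_split massN_def y_u)
    also have "\<dots> = card N + (\<Sum>v\<in>N. massN v) + (\<Sum>v\<in>N. \<Sum>z\<in>nbrs E v \<inter> W. y z)"
      by (simp add: sum.distrib)
    also have "(\<Sum>v\<in>N. \<Sum>z\<in>nbrs E v \<inter> W. y z) = (\<Sum>z\<in>W. dN z * y z)"
      by (subst sum_nbrs_swap) (auto simp: dN_def)
    finally show ?thesis .
  qed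
  have Vs: "V = insert u (N \<union> W)" using u_in NV by (auto simp: W_def)
  have split: "sum f V = f u + sum f N + sum f W" for f :: "'a \<Rightarrow> real"
  proof -
    have "sum f V = sum f (insert u (N \<union> W))" by (rule arg_cong[OF Vs])
    also have "\<dots> = f u + sum f (N \<union> W)" by (rule sum.insert) (auto simp: u_notin W_def)
    also have "sum f (N \<union> W) = sum f N + sum f W" by (rule sum.union_disjoint) (auto simp: W_def)
    finally show ?thesis by simp
  qed
  have deg: "real (card (nbrs E v)) = (if v \<in> N then 1 else 0) + dN v + dW v" if "v \<in> V" for v
    using nbrs_split[OF that, of "\<lambda>_. 1::real"] by (simp add: dN_def dW_def)
  have NW: "(\<Sum>v\<in>N. dW v) = (\<Sum>z\<in>W. dN z)"
    using sum_nbrs_swap[where P=N and Q=W and E=E and f="\<lambda>_ _. 1::real"] by (simp add: dN_def dW_def)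
  have "2 * real (card E) = (\<Sum>v\<in>V. real (card (nbrs E v)))"
    using handshake[OF graph] by (metis of_nat_mult of_nat_numeral of_nat_sum)
  also have "\<dots> = card N + (\<Sum>v\<in>N. 1 + dN v + dW v) + (\<Sum>v\<in>W. dN v + dW v)"
  proof -
    have "(\<Sum>v\<in>N. real (card (nbrs E v))) = (\<Sum>v\<in>N. 1 + dN v + dW v)"
      using NV by (intro sum.cong refl) (auto simp: deg)
    moreover have "(\<Sum>v\<in>W. real (card (nbrs E v))) = (\<Sum>v\<in>W. dN v + dW v)"
      using WV by (intro sum.cong refl) (auto simp: deg W_def)
    ultimately show ?thesis unfolding split by (simp add: N_def)
  qed
  also have "\<dots> = 2 * card N + (\<Sum>v\<in>N. dN v) + 2 * (\<Sum>z\<in>W. dN z) + (\<Sum>z\<in>W. dW z)"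
    by (simp add: sum.distrib NW)
  finally have b: "2 * real (card E) = \<dots>" .
  have "(\<Sum>v\<in>N. \<Sum>w\<in>nbrs E v \<inter> N. y v + y w - 1) \<le> total_excess"
    unfolding total_excess_def by (intro sum_mono) (simp add: excess_def)
  moreover have "(\<Sum>v\<in>N. \<Sum>w\<in>nbrs E v \<inter> N. y v + y w - 1) =
      (\<Sum>v\<in>N. \<Sum>w\<in>nbrs E v \<inter> N. y v) + (\<Sum>v\<in>N. massN v) - (\<Sum>v\<in>N. dN v)"
    by (simp add: sum.distrib sum_subtractf massN_def dN_def)
  moreover have "(\<Sum>v\<in>N. \<Sum>w\<in>nbrs E v \<inter> N. y v) = (\<Sum>v\<in>N. massN v)"
    by (subst sum_nbrs_swap) (auto simp: massN_def)
  ultimately have c: "2 * (\<Sum>v\<in>N. massN v) - (\<Sum>v\<in>N. dN v) \<le> total_excess" by simp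
  have d: "(\<Sum>z\<in>W. dN z * (1 - y z)) = (\<Sum>z\<in>W. dN z) - (\<Sum>z\<in>W. dN z * y z)"
    by (simp add: algebra_simps sum_subtractf)
  show ?thesis using a b c d by (simp add: algebra_simps power2_eq_square)
qed

definition "deficit = (\<Sum>z\<in>W. dN z * (1 - y z))"
definition "edges_W = (\<Sum>z\<in>W. dW z) / 2"

lemma dN_nonneg: "0 \<le> dN v" and dW_nonneg: "0 \<le> dW v" and missing_nonneg: "0 \<le> missing v"
  by (auto simp: dN_def dW_def missing_def)

lemma deficit_nonneg: "0 \<le> deficit" unfolding deficit_def
  using y_le WV by (intro sum_nonneg mult_nonneg_nonneg dN_nonneg) (auto simp: subset_iff)
lemma edges_W_nonneg: "0 \<le> edges_W" unfolding edges_W_def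
  by (simp add: sum_nonneg dW_nonneg)

lemma lam_le_sum_N: "lam \<le> sum y N"
  using sub[OF u_in] by (simp add: y_u N_def)

text \<open>Here $\lambda^2 > m$ enters, and makes the inequality strict. The term $\lambda (\sum_N y - \lambda)$ is
kept because an upper bound for $\sum_N y$ is needed below, and the inequality at \<open>u\<close> gives only the
lower bound $\lambda$.\<close>

lemma excess_pays_for_defects: "deficit + edges_W + lam * (sum y N - lam) < total_excess / 2"
  using edge_by_edge_comparison lam_sq by (simp add: deficit_def edges_W_def)

lemma total_excess_pos: "0 < total_excess"
  using excess_pays_for_defects deficit_nonneg edges_W_nonneg
    mult_nonneg_nonneg[of lam "sum y N - lam"] lam_pos lam_le_sum_N
  by linarith

lemma total_miss_nonneg: "0 \<le> total_miss" unfolding total_miss_def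
  using y_nonneg NV by (intro sum_nonneg mult_nonneg_nonneg missing_nonneg) auto

lemma sum_dN_W_le: "(\<Sum>z\<in>W. dN z) \<le> card E"
proof -
  have NW: "(\<Sum>z\<in>W. dN z) = (\<Sum>v\<in>N. dW v)"
    using sum_nbrs_swap[where P=N and Q=W and E=E and f="\<lambda>_ _. 1::real"] by (simp add: dN_def dW_def)
  have "(\<Sum>z\<in>W. dN z) \<le> (\<Sum>z\<in>W. real (card (nbrs E z)))"
    by (intro sum_mono) (simp add: dN_def card_mono)
  moreover have "(\<Sum>v\<in>N. dW v) \<le> (\<Sum>v\<in>N. real (card (nbrs E v)))"
    by (intro sum_mono) (simp add: dW_def card_mono)
  moreover have "(\<Sum>z\<in>W. real (card (nbrs E z))) + (\<Sum>v\<in>N. real (card (nbrs E v))) =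
      (\<Sum>v\<in>W \<union> N. real (card (nbrs E v)))"
    by (rule sum.union_disjoint[symmetric]) (auto simp: W_def)
  moreover have "(\<Sum>v\<in>W \<union> N. real (card (nbrs E v))) \<le> (\<Sum>v\<in>V. real (card (nbrs E v)))"
    using WV NV finite_V by (intro sum_mono2) auto
  moreover have "(\<Sum>v\<in>V. real (card (nbrs E v))) = 2 * real (card E)"
    using handshake[OF graph] by (metis of_nat_mult of_nat_numeral of_nat_sum)
  ultimately show ?thesis using NW by linarith
qed

lemma card_Wmain_le: "card Wmain \<le> 2 * lam"
proof -
  have "card Wmain * (lam / 2) = (\<Sum>z\<in>Wmain. lam / 2)" by simp
  also have "\<dots> \<le> (\<Sum>z\<in>Wmain. dN z)" by (intro sum_mono) (simp add: Wmain_def)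
  also have "\<dots> \<le> (\<Sum>z\<in>W. dN z)" using WmainW by (intro sum_mono2) (auto simp: dN_nonneg)
  also have "\<dots> < lam\<^sup>2" using sum_dN_W_le lam_sq by linarith
  finally show ?thesis using lam_pos by (simp add: power2_eq_square)
qed

definition "missing_mass z = sum y (N - nbrs E z)"

lemma total_miss_alt: "total_miss = (\<Sum>z\<in>Wmain. missing_mass z)"
proof -
  have "(\<Sum>z\<in>Wmain. missing_mass z) = (\<Sum>z\<in>Wmain. \<Sum>v | v \<in> N \<and> v \<notin> nbrs E z. y v)"
    unfolding missing_mass_def by (intro sum.cong refl) auto
  also have "\<dots> = (\<Sum>v\<in>N. \<Sum>z | z \<in> Wmain \<and> v \<notin> nbrs E z. y v)"
    by (rule sum.swap_restrict) auto
  also have "\<dots> = (\<Sum>v\<in>N. y v * missing v)"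
  proof (intro sum.cong refl)
    fix v
    have "{z. z \<in> Wmain \<and> v \<notin> nbrs E z} = Wmain - nbrs E v" by (auto simp: nbrs_sym)
    then show "(\<Sum>z | z \<in> Wmain \<and> v \<notin> nbrs E z. y v) = y v * missing v" by (simp add: missing_def)
  qed
  finally show ?thesis by (simp add: total_miss_def)
qed

lemma W_subharmonic:
  assumes "z \<in> W"
  shows "lam * y z \<le> sum y (nbrs E z \<inter> N) + dW z"
proof -
  have "z \<in> V" "z \<notin> N" using assms by (auto simp: W_def)
  then have "lam * y z \<le> sum y (nbrs E z \<inter> N) + sum y (nbrs E z \<inter> W)"
    using sub[of z] by (simp add: nbrs_split)
  also have "sum y (nbrs E z \<inter> W) \<le> (\<Sum>_\<in>nbrs E z \<inter> W. 1)"
    using y_le WV by (intro sum_mono) auto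
  finally show ?thesis by (simp add: dW_def)
qed

text \<open>For $z \in W$ the inequality $\lambda y_z \le \sum_{N \cap N(z)} y + d_W(z)$ bounds the weight of \<open>N\<close>
missed by \<open>z\<close> by $(\sum_N y - \lambda) + \lambda (1 - y_z) + d_W(z)$. Over \<open>Wmain\<close> each of the three terms
adds up to at most twice the corresponding defect: the first because \<open>Wmain\<close> has at most $2 \lambda$
elements, the second because $\lambda \le 2 d_N(z)$ there.\<close>

lemma total_miss_le_total_excess: "total_miss \<le> total_excess"
proof -
  have "total_miss \<le> (\<Sum>z\<in>Wmain. (sum y N - lam) + lam * (1 - y z) + dW z)"
    unfolding total_miss_alt
  proof (intro sum_mono)
    fix z assume "z \<in> Wmain"
    then have "lam * y z \<le> sum y (nbrs E z \<inter> N) + dW z" using W_subharmonic WmainW by auto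
    moreover have "sum y N = missing_mass z + sum y (nbrs E z \<inter> N)"
      using sum.Int_Diff[of N y "nbrs E z"] by (simp add: missing_mass_def Int_commute)
    ultimately show "missing_mass z \<le> (sum y N - lam) + lam * (1 - y z) + dW z"
      by (simp add: algebra_simps)
  qed
  also have "\<dots> = card Wmain * (sum y N - lam) + (\<Sum>z\<in>Wmain. lam * (1 - y z)) + (\<Sum>z\<in>Wmain. dW z)"
    by (simp add: sum.distrib)
  also have "card Wmain * (sum y N - lam) \<le> 2 * lam * (sum y N - lam)"
    using lam_le_sum_N card_Wmain_le by (intro mult_right_mono) auto
  also have "(\<Sum>z\<in>Wmain. lam * (1 - y z)) \<le> (\<Sum>z\<in>Wmain. 2 * (dN z * (1 - y z)))"
  proof (intro sum_mono)
    fix z assume "z \<in> Wmain"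
    then have "lam \<le> 2 * dN z" "0 \<le> 1 - y z" using y_le WmainW WV by (auto simp: Wmain_def)
    from mult_right_mono[OF this] show "lam * (1 - y z) \<le> 2 * (dN z * (1 - y z))" by (simp add: mult.assoc)
  qed
  also have "\<dots> \<le> 2 * deficit" unfolding deficit_def sum_distrib_left
  proof (rule sum_mono2[OF finite_W WmainW])
    fix z assume "z \<in> W - Wmain"
    then have "y z \<le> 1" using y_le WV by auto
    then show "0 \<le> 2 * (dN z * (1 - y z))" by (simp add: dN_nonneg)
  qed
  also have "(\<Sum>z\<in>Wmain. dW z) \<le> 2 * edges_W" unfolding edges_W_def
    using WmainW sum_mono2[OF finite_W WmainW, of dW] by (simp add: dW_nonneg)
  finally show ?thesis using excess_pays_for_defects by linarith
qed

text \<open>A vertex $z \in W$ outside \<open>Wmain\<close> satisfies $\lambda y_z \le d_N(z) + d_W(z)$ with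
$d_N(z) < \lambda / 2$. Either $1 - y_z \ge 1/4$, so that its edges to \<open>N\<close> are paid for as deficit, or
$y_z > 3/4$, which forces $d_W(z) > \lambda / 4$.\<close>

lemma lam_light_le: "lam * light \<le> 4 * total_excess"
proof -
  have "lam * light \<le> (\<Sum>z\<in>W - Wmain. 4 * (dN z * (1 - y z)) + 4 * dW z)"
    unfolding light_def sum_distrib_left
  proof (intro sum_mono)
    fix z assume z: "z \<in> W - Wmain"
    then have lt: "dN z < lam / 2" and zV: "z \<in> V" using WV by (auto simp: Wmain_def)
    have "sum y (nbrs E z \<inter> N) \<le> (\<Sum>_\<in>nbrs E z \<inter> N. 1)"
      using y_le NV by (intro sum_mono) auto
    then have b: "lam * y z \<le> dN z + dW z" using W_subharmonic[of z] z by (simp add: dN_def)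
    show "lam * y z \<le> 4 * (dN z * (1 - y z)) + 4 * dW z"
    proof (cases "y z \<le> 3/4")
      case True
      then have "dN z * (1/4) \<le> dN z * (1 - y z)" by (intro mult_left_mono) (auto simp: dN_nonneg)
      then show ?thesis using b dW_nonneg[of z] by linarith
    next
      case False
      then have "lam * (3/4) \<le> lam * y z" using lam_pos by (intro mult_left_mono) auto
      moreover have "lam * y z \<le> lam * 1" using lam_pos y_le[OF zV] by (intro mult_left_mono) auto
      moreover have "0 \<le> dN z * (1 - y z)" using dN_nonneg y_le[OF zV] by simp
      ultimately show ?thesis using b lt by linarith
    qed
  qed
  also have "\<dots> \<le> (\<Sum>z\<in>W. 4 * (dN z * (1 - y z)) + 4 * dW z)"
  proof (rule sum_mono2[OF finite_W])
    fix z assume "z \<in> W - (W - Wmain)"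
    then have "y z \<le> 1" using y_le WV by auto
    then show "0 \<le> 4 * (dN z * (1 - y z)) + 4 * dW z" by (simp add: dN_nonneg dW_nonneg)
  qed auto
  also have "\<dots> = 4 * deficit + 8 * edges_W" by (simp add: deficit_def edges_W_def sum.distrib flip: sum_distrib_left)
  also have "\<dots> \<le> 4 * total_excess"
    using excess_pays_for_defects deficit_nonneg edges_W_nonneg mult_nonneg_nonneg[of lam "sum y N - lam"] lam_pos lam_le_sum_N
  by linarith
  finally show ?thesis .
qed

lemma sum_y_le: "lam * sum y V \<le> 2 * real (card E)"
proof -
  have "lam * sum y V = (\<Sum>v\<in>V. lam * y v)" by (simp add: sum_distrib_left)
  also have "\<dots> \<le> (\<Sum>v\<in>V. sum y (nbrs E v))" using sub by (intro sum_mono) auto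
  also have "\<dots> \<le> (\<Sum>v\<in>V. \<Sum>w\<in>nbrs E v \<inter> V. y w)"
    using nbrs_subset[OF graph] by (intro sum_mono) (simp add: Int_absorb2)
  also have "\<dots> = (\<Sum>w\<in>V. \<Sum>v\<in>nbrs E w \<inter> V. y w)" by (rule sum_nbrs_swap[OF finite_V finite_V])
  also have "\<dots> \<le> (\<Sum>w\<in>V. real (card (nbrs E w)))"
  proof (intro sum_mono)
    fix w assume "w \<in> V"
    then have "(\<Sum>v\<in>nbrs E w \<inter> V. y w) \<le> (\<Sum>v\<in>nbrs E w \<inter> V. 1)" using y_le by (intro sum_mono) auto
    also have "\<dots> \<le> real (card (nbrs E w))" by (auto intro!: card_mono)
    finally show "(\<Sum>v\<in>nbrs E w \<inter> V. y w) \<le> real (card (nbrs E w))" .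
  qed
  also have "\<dots> = 2 * real (card E)"
    using handshake[OF graph] by (metis of_nat_mult of_nat_numeral of_nat_sum)
  finally show ?thesis .
qed

lemma massN_le: "massN v \<le> dN v"
proof -
  have "massN v \<le> (\<Sum>_\<in>nbrs E v \<inter> N. 1)"
    unfolding massN_def using y_le NV by (intro sum_mono) auto
  then show ?thesis by (simp add: dN_def)
qed

lemma massN_nonneg: "0 \<le> massN v"
  unfolding massN_def using y_nonneg NV by (intro sum_nonneg) auto

lemma N_subharmonic:
  assumes "v \<in> N"
  shows "lam * y v \<le> 1 + massN v + light + card (Wmain \<inter> nbrs E v)"
proof -
  have vV: "v \<in> V" using assms NV by auto
  have "lam * y v \<le> 1 + massN v + sum y (nbrs E v \<inter> W)"
    using sub[OF vV] assms by (simp add: nbrs_split[OF vV] y_u massN_def)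
  also have "sum y (nbrs E v \<inter> W) = sum y (nbrs E v \<inter> (W - Wmain)) + sum y (Wmain \<inter> nbrs E v)"
  proof -
    have "nbrs E v \<inter> W \<inter> Wmain = Wmain \<inter> nbrs E v" "nbrs E v \<inter> W - Wmain = nbrs E v \<inter> (W - Wmain)"
      using WmainW by auto
    then show ?thesis using sum.Int_Diff[of "nbrs E v \<inter> W" y Wmain] by simp
  qed
  also have "sum y (nbrs E v \<inter> (W - Wmain)) \<le> light" unfolding light_def
    using y_nonneg WV by (intro sum_mono2) auto
  also have "sum y (Wmain \<inter> nbrs E v) \<le> (\<Sum>_\<in>Wmain \<inter> nbrs E v. 1)"
    using y_le WmainW WV by (intro sum_mono) auto
  finally show ?thesis by simp
qed

lemma missing_eq: "missing v = card Wmain - real (card (Wmain \<inter> nbrs E v))"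
proof -
  have "card Wmain = card (Wmain \<inter> nbrs E v) + card (Wmain - nbrs E v)"
    using card_Int_Diff[of Wmain "nbrs E v"] by simp
  then show ?thesis by (simp add: missing_def)
qed

end

section \<open>The contradiction when all codegrees are small and few are linear\<close>

text \<open>The negation of the dichotomy. The thresholds will be $b = (1/2 - \epsilon) r$, $d = \delta r$ and
$q = \theta r$ with $\delta$ much smaller than $\theta$ and $\theta$ much smaller than $\epsilon$.\<close>

locale small_books = subeigenvector +
  fixes b d q L :: real
  assumes r_pos: "0 < r"
    and d_pos: "0 < d" and d_less: "d < q"
    and codegree_less: "\<And>v w. {v, w} \<in> E \<Longrightarrow> codegree E v w < b"
    and few_heavy: "card (heavy_pairs E d) \<le> L"
begin

text \<open>\<open>X\<close> collects the exceptional vertices, with much weight of \<open>N\<close> in their neighbourhood. The quantity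
\<open>err\<close> adds up all lower order terms of this section, so that one smallness condition on it serves
everywhere.\<close>

definition "X = {v \<in> N. q \<le> massN v}"
definition "err = 1 + q + light + L + total_excess / (q - d)"

lemma finite_X[simp]: "finite X" by (simp add: X_def)
lemma XN: "X \<subseteq> N" by (auto simp: X_def)

lemma L_nonneg: "0 \<le> L" using few_heavy by (meson of_nat_0_le_iff order_trans)

lemma dN_eq: "dN v = codegree E u v"
  by (simp add: dN_def codegree_def N_def Int_commute)

lemma dN_less:
  assumes "v \<in> N"
  shows "dN v < b"
  using codegree_less[of u v] assms by (simp add: dN_eq N_def nbrs_def)

lemma heavy_at:
  assumes "A \<subseteq> nbrs E v" "\<And>w. w \<in> A \<Longrightarrow> d \<le> codegree E v w"
  shows "card A \<le> L"
proof -
  have "card A = card (Pair v ` A)" by (rule card_image[symmetric]) (auto simp: inj_on_def)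
  also have "\<dots> \<le> card (heavy_pairs E d)"
    by (rule card_mono[OF finite_heavy_pairs[OF graph]])
      (use assms in \<open>auto simp: heavy_pairs_def nbrs_def\<close>)
  finally show ?thesis using few_heavy by linarith
qed

lemma b_pos: "0 < b"
proof -
  have "E \<noteq> {}" using r_pos by (auto simp: r_def)
  then obtain e where e: "e \<in> E" by auto
  then have "card e = 2" using graph by (auto simp: simple_graph_def)
  then obtain v w where "e = {v, w}" by (auto simp: card_2_iff)
  then have "codegree E v w < b" using codegree_less e by auto
  then show ?thesis by (meson of_nat_0_le_iff order_le_less_trans)
qed

lemma sum_y_N: "sum y N \<le> 2 * r"
proof -
  have "sum y N \<le> sum y V" using y_nonneg NV by (intro sum_mono2) auto
  moreover have "r * sum y V \<le> lam * sum y V"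
    using r_lam y_nonneg by (intro mult_right_mono sum_nonneg) auto
  then have "r * sum y V \<le> 2 * (r * r)" using sum_y_le r_sq by (simp add: power2_eq_square)
  then have "sum y V \<le> 2 * r" using r_pos by (simp add: mult.left_commute)
  ultimately show ?thesis by linarith
qed

text \<open>An a priori bound, small compared with $m = r^2$. Since $e_{vw} \le y_v y_w$ for the excess, the total is
at most $\sum_{v \in N} y_v \cdot y(N(v) \cap N)$; here the second factor is below \<open>d\<close> except for the at
most \<open>L\<close> vertices \<open>v\<close> for which \<open>uv\<close> has codegree at least \<open>d\<close>, and $\sum_N y \le 2 r$.\<close>

lemma total_excess_le: "total_excess \<le> 2 * d * r + L * b"
proof -
  define X0 where "X0 = {v \<in> N. d \<le> dN v}"
  have cX0: "card X0 \<le> L"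
    by (rule heavy_at[where v = u]) (auto simp: X0_def dN_eq N_def)
  have "total_excess \<le> (\<Sum>v\<in>N. \<Sum>w\<in>nbrs E v \<inter> N. y v * y w)"
    unfolding total_excess_def using NV by (intro sum_mono excess_le_prod) auto
  also have "\<dots> = (\<Sum>v\<in>N. y v * massN v)" by (simp add: massN_def sum_distrib_left)
  also have "\<dots> \<le> (\<Sum>v\<in>N. d * y v + (if v \<in> X0 then b else 0))"
  proof (rule sum_mono)
    fix v assume v: "v \<in> N"
    then have y: "0 \<le> y v" "y v \<le> 1" using y_nonneg y_le NV by auto
    show "y v * massN v \<le> d * y v + (if v \<in> X0 then b else 0)"
    proof (cases "v \<in> X0")
      case True
      have "y v * massN v \<le> 1 * b"
        using y massN_le[of v] dN_less[OF v] massN_nonneg[of v] by (intro mult_mono) auto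
      moreover have "0 \<le> d * y v" using d_pos y by simp
      ultimately show ?thesis using True by simp
    next
      case False
      then have "massN v \<le> d" using massN_le[of v] v by (simp add: X0_def)
      then have "y v * massN v \<le> y v * d" using y by (intro mult_left_mono) auto
      then show ?thesis using False by (simp add: mult.commute)
    qed
  qed
  also have "\<dots> = d * sum y N + card X0 * b"
  proof -
    have "(\<Sum>v\<in>N. if v \<in> X0 then b else 0) = (\<Sum>v\<in>N \<inter> X0. b)"
      by (rule sum.inter_restrict[symmetric]) simp
    also have "N \<inter> X0 = X0" by (auto simp: X0_def)
    finally show ?thesis by (simp add: sum.distrib sum_distrib_left)
  qed
  also have "\<dots> \<le> d * (2 * r) + L * b"
    using sum_y_N d_pos cX0 b_pos by (intro add_mono mult_mono mult_left_mono mult_right_mono) auto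
  finally show ?thesis by simp
qed

lemma light_nonneg: "0 \<le> light" unfolding light_def using y_nonneg WV by (intro sum_nonneg) auto

lemma light_le_frac: "light \<le> 4 * total_excess / r"
proof -
  have "r * light \<le> lam * light" using r_lam light_nonneg by (intro mult_right_mono) auto
  then show ?thesis using lam_light_le r_pos by (simp add: field_simps)
qed

lemma frac_nonneg: "0 \<le> total_excess / (q - d)" using total_excess_pos d_less by simp

lemma err_nonneg: "0 \<le> err"
  using L_nonneg frac_nonneg light_nonneg d_pos d_less unfolding err_def by linarith

text \<open>An exceptional vertex \<open>x\<close> belongs to the side of \<open>W\<close> rather than to that of \<open>N\<close>: if $z \in Wmain$ is
adjacent to \<open>x\<close> and \<open>xz\<close> is not one of the at most \<open>L\<close> heavy pairs at \<open>x\<close>, then \<open>z\<close> misses weight at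
least $q - d$ of $N \cap N(x)$. Together these missed weights are at most the total excess.\<close>

lemma X_Wmain_le:
  assumes "x \<in> X"
  shows "card (Wmain \<inter> nbrs E x) \<le> L + total_excess / (q - d)"
proof -
  define B where "B = Wmain \<inter> nbrs E x"
  define B1 where "B1 = {z \<in> B. d \<le> codegree E x z}"
  have fB: "finite B" by (simp add: B_def)
  have cB1: "card B1 \<le> L" by (rule heavy_at[where v = x]) (auto simp: B1_def B_def)
  have missing_mass_nonneg: "0 \<le> missing_mass z" for z
    unfolding missing_mass_def using y_nonneg NV by (intro sum_nonneg) auto
  have missing_mass_ge: "q - d \<le> missing_mass z" if z: "z \<in> B - B1" for z
  proof -
    have "q \<le> massN x" using assms by (simp add: X_def)
    also have "massN x = sum y (nbrs E x \<inter> N \<inter> nbrs E z) + sum y (nbrs E x \<inter> N - nbrs E z)"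
      unfolding massN_def by (rule sum.Int_Diff) simp
    also have "sum y (nbrs E x \<inter> N - nbrs E z) \<le> missing_mass z"
      unfolding missing_mass_def using y_nonneg NV by (intro sum_mono2) auto
    also have "sum y (nbrs E x \<inter> N \<inter> nbrs E z) \<le> (\<Sum>_\<in>nbrs E x \<inter> N \<inter> nbrs E z. 1)"
      using y_le NV by (intro sum_mono) auto
    also have "\<dots> \<le> real (codegree E x z)"
      unfolding codegree_def by (auto intro!: card_mono)
    also have "\<dots> < d" using z by (auto simp: B1_def)
    finally show ?thesis by simp
  qed
  have "(real (card B) - card B1) * (q - d) = card (B - B1) * (q - d)"
    using card_Diff_subset[of B1 B] card_mono[of B B1] fB by (simp add: B1_def of_nat_diff)
  also have "\<dots> = (\<Sum>z\<in>B - B1. q - d)" by simp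
  also have "\<dots> \<le> (\<Sum>z\<in>B - B1. missing_mass z)" using missing_mass_ge by (rule sum_mono)
  also have "\<dots> \<le> total_miss" unfolding total_miss_alt
    by (rule sum_mono2) (auto simp: B_def missing_mass_nonneg)
  also have "\<dots> \<le> total_excess" by (rule total_miss_le_total_excess)
  finally have "real (card B) - card B1 \<le> total_excess / (q - d)" using d_less by (simp add: pos_le_divide_eq)
  then show ?thesis using cB1 unfolding B_def by linarith
qed

lemma X_weight:
  assumes "x \<in> X"
  shows "lam * y x \<le> b + err"
proof -
  have "x \<in> N" using assms XN by auto
  then show ?thesis
    using N_subharmonic[of x] massN_le[of x] dN_less[of x] X_Wmain_le[OF assms] d_less d_pos unfolding err_def by linarith
qed

lemma X_missing:
  assumes "x \<in> X"
  shows "card Wmain - err \<le> missing x"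
  using X_Wmain_le[OF assms] d_less d_pos light_nonneg unfolding missing_eq err_def by linarith

lemma notX_weight:
  assumes "v \<in> N - X"
  shows "lam * y v \<le> err + card (Wmain \<inter> nbrs E v)"
  using N_subharmonic[of v] assms L_nonneg frac_nonneg unfolding err_def X_def by auto

lemma notX_weight_le:
  assumes "v \<in> N - X"
  shows "lam * y v \<le> err + card Wmain"
proof -
  have "card (Wmain \<inter> nbrs E v) \<le> card Wmain" by (intro card_mono) auto
  then show ?thesis using notX_weight[OF assms] by linarith
qed

lemma excess_pos:
  assumes "0 < excess v w"
  shows "r < lam * y v + lam * y w"
proof -
  have "1 < y v + y w" using assms by (auto simp: excess_def max_def split: if_splits)
  then have "lam * 1 < lam * (y v + y w)" using lam_pos by (intro mult_strict_left_mono) auto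
  then show ?thesis using r_lam by (simp add: algebra_simps)
qed

text \<open>An edge of positive excess exists, and $\lambda (y_v + y_w) > r$ at its ends. Since exceptional vertices
have weight less than about $1/2$, one end is not exceptional and draws its weight from \<open>Wmain\<close>.\<close>

lemma card_Wmain_ge:
  assumes "err \<le> r / 8" "b + err \<le> r / 2"
  shows "r / 4 \<le> card Wmain"
proof -
  have "\<exists>v\<in>N. \<exists>w\<in>nbrs E v \<inter> N. excess v w \<noteq> 0"
  proof (rule ccontr)
    assume "\<not> ?thesis"
    then have "total_excess = 0" unfolding total_excess_def by (intro sum.neutral) auto
    then show False using total_excess_pos by simp
  qed
  then obtain v w where vw: "v \<in> N" "w \<in> N" "0 < excess v w"
    using excess_nonneg by (metis IntD2 order_less_le)
  from excess_pos[OF this(3)] have gt: "r < lam * y v + lam * y w" .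
  consider "v \<in> X" "w \<in> X" | "v \<in> X" "w \<in> N - X" | "v \<in> N - X" "w \<in> X" | "v \<in> N - X" "w \<in> N - X"
    using vw by auto
  then show ?thesis
  proof cases
    case 1 then show ?thesis using X_weight[of v] X_weight[of w] gt assms by linarith
  next
    case 2 then show ?thesis using X_weight[of v] notX_weight_le[of w] gt assms by linarith
  next
    case 3 then show ?thesis using X_weight[of w] notX_weight_le[of v] gt assms by linarith
  next
    case 4 then show ?thesis using notX_weight_le[of w] notX_weight_le[of v] gt assms by linarith
  qed
qed

lemma Wmain_common_le:
  assumes "{v, w} \<in> E"
  shows "card (Wmain \<inter> nbrs E v) + real (card (Wmain \<inter> nbrs E w)) \<le> codegree E v w + card Wmain"
proof -
  have "card (Wmain \<inter> nbrs E v) + card (Wmain \<inter> nbrs E w) =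
      card (Wmain \<inter> nbrs E v \<union> Wmain \<inter> nbrs E w) + card (Wmain \<inter> nbrs E v \<inter> (Wmain \<inter> nbrs E w))"
    by (rule card_Un_Int) auto
  moreover have "card (Wmain \<inter> nbrs E v \<union> Wmain \<inter> nbrs E w) \<le> card Wmain" by (intro card_mono) auto
  moreover have "card (Wmain \<inter> nbrs E v \<inter> (Wmain \<inter> nbrs E w)) \<le> codegree E v w"
    unfolding codegree_def by (intro card_mono) auto
  ultimately show ?thesis by linarith
qed

lemma missing_sum_ge:
  assumes "{v, w} \<in> E"
  shows "card Wmain - real (codegree E v w) \<le> missing v + missing w"
  using Wmain_common_le[OF assms] unfolding missing_eq by linarith

text \<open>The excess is at most the smaller of the two weights, so it can be charged to the vertices missed by
either end, whichever end misses them.\<close>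

lemma excess_mult_missing:
  assumes "v \<in> N" "w \<in> N"
  shows "excess v w * (missing v + missing w) \<le> y v * missing v + y w * missing w"
proof -
  have "v \<in> V" "w \<in> V" using assms NV by auto
  then have "excess v w * missing v \<le> y v * missing v" "excess v w * missing w \<le> y w * missing w"
    using excess_le[of v w] by (auto intro!: mult_right_mono simp: missing_nonneg)
  then show ?thesis by (simp add: distrib_left)
qed

lemma y_missing_le_total_miss:
  assumes "v \<in> N" "w \<in> N" "v \<noteq> w"
  shows "y v * missing v + y w * missing w \<le> total_miss"
proof -
  have "(\<Sum>x\<in>{v, w}. y x * missing x) \<le> total_miss"
    unfolding total_miss_def using assms y_nonneg NV missing_nonneg
    by (intro sum_mono2) (auto intro!: mult_nonneg_nonneg)
  then show ?thesis using assms(3) by simp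
qed

text \<open>The charge of an edge inside \<open>N\<close> to an exceptional end \<open>v\<close>, and its charge to a nonexceptional end, the
latter still to be multiplied by the weight of the other end.\<close>

definition "charge_X k v = (if v \<in> X then y v * missing v * k else 0)"
definition "charge_N v = (if v \<in> X then 0 else y v * missing v / (card Wmain - d))"

text \<open>Two exceptional ends have too little weight for positive excess. If only \<open>v\<close> is exceptional, it misses
nearly all of \<open>Wmain\<close> while $y_w$ is at most about $|Wmain| / r$. If neither end is exceptional and the
codegree is below \<open>d\<close>, then \<open>v\<close> and \<open>w\<close> together miss at least $|Wmain| - d$ vertices of \<open>Wmain\<close>, counted
with multiplicity. For the remaining, heavy pairs the number of missed vertices is bounded below by
$\lambda (y_v + y_w)$ minus twice the codegree, that is, by about $r - 2 b$.\<close>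

lemma excess_bound:
  assumes v: "v \<in> N" and w: "w \<in> N" and E: "{v, w} \<in> E"
    and bh: "2 * b + 2 * err < r" and hW: "err < card Wmain" and dW: "d < card Wmain"
    and k: "k = (card Wmain + err) / (r * (card Wmain - err))"
  shows "excess v w \<le> charge_X k v + charge_X k w + charge_N v * y w + charge_N w * y v
     + (if (v, w) \<in> heavy_pairs E d then total_miss / (r - 2 * b - 2 * err) else 0)"
proof -
  have vV: "v \<in> V" and wV: "w \<in> V" using v w NV by auto
  have k0: "0 \<le> k" unfolding k using err_nonneg r_pos hW by (intro divide_nonneg_pos mult_pos_pos) auto
  have ym: "0 \<le> y z * missing z" if "z \<in> N" for z
    using y_nonneg[of z] missing_nonneg[of z] that NV by auto
  have cX0: "0 \<le> charge_X k z" if "z \<in> N" for z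
    using k0 ym[OF that] by (simp add: charge_X_def)
  have cY0: "0 \<le> charge_N z" if "z \<in> N" for z
    using ym[OF that] dW by (simp add: charge_N_def)
  have cYy: "0 \<le> charge_N v * y w" "0 \<le> charge_N w * y v"
    using cY0[OF v] cY0[OF w] y_nonneg[OF vV] y_nonneg[OF wV] by simp_all
  have last0: "0 \<le> (if (v, w) \<in> heavy_pairs E d then total_miss / (r - 2 * b - 2 * err) else 0)"
    using total_miss_nonneg bh by simp
  show ?thesis
  proof (cases "excess v w = 0")
    case True
    then show ?thesis using cX0[OF v] cX0[OF w] cYy last0 by linarith
  next
    case False
    then have pos: "0 < excess v w" using excess_nonneg[of v w] by simp
    have gt: "r < lam * y v + lam * y w" by (rule excess_pos[OF pos])
    have mixed: "excess v' w' \<le> charge_X k v'"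
      if "v' \<in> X" "w' \<in> N - X" for v' w'
    proof -
      have V': "v' \<in> V" "w' \<in> V" using that XN NV by auto
      have yv: "0 \<le> y v'" and yw: "0 \<le> y w'" using V' y_nonneg by auto
      have "r * y w' \<le> lam * y w'" using r_lam yw by (intro mult_right_mono) auto
      then have "r * y w' \<le> card Wmain + err" using notX_weight_le[OF that(2)] by linarith
      then have "y w' \<le> (card Wmain + err) / r" using r_pos by (simp add: pos_le_divide_eq mult.commute)
      also have "\<dots> = (card Wmain - err) * k" unfolding k using hW r_pos by (simp add: field_simps)
      also have "\<dots> \<le> missing v' * k" using X_missing[OF that(1)] k0 by (intro mult_right_mono)
      finally have "y v' * y w' \<le> y v' * (missing v' * k)" using yv by (rule mult_left_mono)
      then show ?thesis using excess_le_prod[OF V'] that by (simp add: charge_X_def mult.assoc)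
    qed
    consider "v \<in> X" "w \<in> X" | "v \<in> X" "w \<in> N - X" | "v \<in> N - X" "w \<in> X" | "v \<in> N - X" "w \<in> N - X"
      using v w by auto
    then show ?thesis
    proof cases
      case 1
      then have False using X_weight[of v] X_weight[of w] gt bh by linarith
      then show ?thesis ..
    next
      case 2
      then show ?thesis using mixed[of v w] cX0[OF w] cYy last0 by linarith
    next
      case 3
      have "excess v w = excess w v" by (simp add: excess_def add.commute)
      then show ?thesis using mixed[of w v] 3 cX0[OF v] cYy last0 by linarith
    next
      case 4
      show ?thesis
      proof (cases "(v, w) \<in> heavy_pairs E d")
        case True
        have "r < 2 * err + card (Wmain \<inter> nbrs E v) + card (Wmain \<inter> nbrs E w)"
          using gt notX_weight[of v] notX_weight[of w] 4 by linarith
        also have "\<dots> \<le> 2 * err + 2 * codegree E v w + missing v + missing w"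
          using Wmain_common_le[OF E] unfolding missing_eq by linarith
        finally have "r - 2 * b - 2 * err \<le> missing v + missing w" using codegree_less[OF E] by linarith
        then have "excess v w * (r - 2 * b - 2 * err) \<le> excess v w * (missing v + missing w)"
          using pos by (intro mult_left_mono) auto
        also have "\<dots> \<le> y v * missing v + y w * missing w" by (rule excess_mult_missing[OF v w])
        also have "\<dots> \<le> total_miss"
        proof (rule y_missing_le_total_miss[OF v w])
          show "v \<noteq> w" using nbrs_irrefl[OF graph, of v] E by (auto simp: nbrs_def)
        qed
        finally have "excess v w \<le> total_miss / (r - 2 * b - 2 * err)" using bh by (simp add: pos_le_divide_eq)
        moreover have "(if (v, w) \<in> heavy_pairs E d then total_miss / (r - 2 * b - 2 * err) else 0) = total_miss / (r - 2 * b - 2 * err)"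
          using True by simp
        ultimately show ?thesis using cX0[OF v] cX0[OF w] cYy by linarith
      next
        case False
        then have "codegree E v w < d" using E by (auto simp: heavy_pairs_def)
        then have "card Wmain - d \<le> missing v + missing w" using missing_sum_ge[OF E] by linarith
        then have "excess v w * (card Wmain - d) \<le> (y v * y w) * (missing v + missing w)"
          using excess_le_prod[OF vV wV] dW excess_nonneg y_nonneg vV wV
          by (intro mult_mono) auto
        then have "excess v w \<le> (y v * y w) * (missing v + missing w) / (card Wmain - d)"
          using dW by (simp add: pos_le_divide_eq)
        also have "\<dots> = charge_N v * y w + charge_N w * y v" using 4
          by (simp add: charge_N_def add_divide_distrib[symmetric] algebra_simps)
        finally show ?thesis using cX0[OF v] cX0[OF w] last0 by linarith
      qed
    qed
  qed
qed

text \<open>Summing the charges over \<open>N\<close>: an exceptional vertex is charged by fewer than \<open>b\<close> edges, a vertex outside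
\<open>X\<close> by edges whose other ends have total weight at most \<open>q\<close>, and in both cases once for each of the two
orders of the pair; the heavy pairs add at most \<open>L\<close> equal terms. The result is a bound of the total excess by the right-hand side times
\<open>total_miss\<close>, which in turn is at most the total excess.\<close>

lemma contraction:
  assumes bh: "2 * b + 2 * err < r" and hW: "err < card Wmain" and dW: "d < card Wmain"
  shows "1 \<le> 2 * b * (card Wmain + err) / (r * (card Wmain - err)) + 2 * q / (card Wmain - d)
    + L / (r - 2 * b - 2 * err)"
proof -
  define k where "k = (card Wmain + err) / (r * (card Wmain - err))"
  define e where "e = r - 2 * b - 2 * err"
  define a where "a = real (card Wmain) - d"
  have a0: "0 < a" using dW by (simp add: a_def)
  have e0: "0 < e" using bh by (simp add: e_def)
  have k0: "0 \<le> k" unfolding k_def using err_nonneg r_pos hW by (intro divide_nonneg_pos mult_pos_pos) auto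
  have adj: "{v, w} \<in> E" if "w \<in> nbrs E v" for v w using that by (simp add: nbrs_def)
  have ym: "0 \<le> y v * missing v" if "v \<in> N" for v
    using that NV y_nonneg missing_nonneg by (auto intro!: mult_nonneg_nonneg)
  have "total_excess \<le> (\<Sum>v\<in>N. \<Sum>w\<in>nbrs E v \<inter> N. charge_X k v + charge_X k w + charge_N v * y w + charge_N w * y v
     + (if (v, w) \<in> heavy_pairs E d then total_miss / e else 0))"
    unfolding total_excess_def e_def
    by (intro sum_mono excess_bound[OF _ _ _ bh hW dW k_def]) (auto simp: adj)
  also have "\<dots> = (\<Sum>v\<in>N. \<Sum>w\<in>nbrs E v \<inter> N. charge_X k v) + (\<Sum>v\<in>N. \<Sum>w\<in>nbrs E v \<inter> N. charge_X k w)
     + (\<Sum>v\<in>N. \<Sum>w\<in>nbrs E v \<inter> N. charge_N v * y w) + (\<Sum>v\<in>N. \<Sum>w\<in>nbrs E v \<inter> N. charge_N w * y v)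
     + (\<Sum>v\<in>N. \<Sum>w\<in>nbrs E v \<inter> N. if (v, w) \<in> heavy_pairs E d then total_miss / e else 0)"
    by (simp only: sum.distrib)
  also have "(\<Sum>v\<in>N. \<Sum>w\<in>nbrs E v \<inter> N. charge_X k w) = (\<Sum>v\<in>N. \<Sum>w\<in>nbrs E v \<inter> N. charge_X k v)"
    by (rule sum_nbrs_swap) auto
  also have "(\<Sum>v\<in>N. \<Sum>w\<in>nbrs E v \<inter> N. charge_N w * y v) = (\<Sum>v\<in>N. \<Sum>w\<in>nbrs E v \<inter> N. charge_N v * y w)"
    by (rule sum_nbrs_swap) auto
  also have "(\<Sum>v\<in>N. \<Sum>w\<in>nbrs E v \<inter> N. charge_X k v) \<le> b * k * (\<Sum>v\<in>X. y v * missing v)"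
  proof -
    have "(\<Sum>v\<in>N. \<Sum>w\<in>nbrs E v \<inter> N. charge_X k v) = (\<Sum>v\<in>N. dN v * charge_X k v)" by (simp add: dN_def)
    also have "\<dots> \<le> (\<Sum>v\<in>N. b * charge_X k v)"
      using ym k0 by (intro sum_mono mult_right_mono less_imp_le[OF dN_less]) (auto simp: charge_X_def)
    also have "\<dots> = (\<Sum>v\<in>N. if v \<in> X then b * k * (y v * missing v) else 0)"
      by (intro sum.cong) (auto simp: charge_X_def)
    also have "\<dots> = (\<Sum>v\<in>N \<inter> X. b * k * (y v * missing v))"
      by (rule sum.inter_restrict[symmetric]) simp
    also have "N \<inter> X = X" using XN by auto
    finally show ?thesis by (simp add: sum_distrib_left)
  qed
  also have "(\<Sum>v\<in>N. \<Sum>w\<in>nbrs E v \<inter> N. charge_N v * y w) \<le> q / a * total_miss"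
  proof -
    have "(\<Sum>v\<in>N. \<Sum>w\<in>nbrs E v \<inter> N. charge_N v * y w) = (\<Sum>v\<in>N. charge_N v * massN v)"
      by (simp add: massN_def sum_distrib_left)
    also have "\<dots> \<le> (\<Sum>v\<in>N. q / a * (y v * missing v))"
    proof (rule sum_mono)
      fix v assume v: "v \<in> N"
      show "charge_N v * massN v \<le> q / a * (y v * missing v)"
      proof (cases "v \<in> X")
        case True
        then show ?thesis using ym[OF v] a0 d_pos d_less by (simp add: charge_N_def)
      next
        case False
        then have "massN v \<le> q" using v by (simp add: X_def)
        then have "(y v * missing v / a) * massN v \<le> (y v * missing v / a) * q"
          using ym[OF v] a0 by (intro mult_left_mono) auto
        then show ?thesis using False by (simp add: charge_N_def a_def mult.commute)
      qed
    qed
    finally show ?thesis by (simp add: total_miss_def sum_distrib_left)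
  qed
  also have "(\<Sum>v\<in>N. \<Sum>w\<in>nbrs E v \<inter> N. if (v, w) \<in> heavy_pairs E d then total_miss / e else 0) \<le> L * (total_miss / e)"
  proof -
    have fin: "finite (SIGMA v:N. nbrs E v \<inter> N)" by auto
    have "(\<Sum>v\<in>N. \<Sum>w\<in>nbrs E v \<inter> N. if (v, w) \<in> heavy_pairs E d then total_miss / e else 0)
       = (\<Sum>p\<in>(SIGMA v:N. nbrs E v \<inter> N). if p \<in> heavy_pairs E d then total_miss / e else 0)"
      by (subst sum.Sigma) auto
    also have "\<dots> = (\<Sum>p\<in>(SIGMA v:N. nbrs E v \<inter> N) \<inter> heavy_pairs E d. total_miss / e)"
      by (rule sum.inter_restrict[symmetric, OF fin])
    also have "\<dots> = card ((SIGMA v:N. nbrs E v \<inter> N) \<inter> heavy_pairs E d) * (total_miss / e)" by simp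
    also have "\<dots> \<le> L * (total_miss / e)"
    proof (rule mult_right_mono)
      have "card ((SIGMA v:N. nbrs E v \<inter> N) \<inter> heavy_pairs E d) \<le> card (heavy_pairs E d)"
        by (intro card_mono finite_heavy_pairs[OF graph]) auto
      then show "card ((SIGMA v:N. nbrs E v \<inter> N) \<inter> heavy_pairs E d) \<le> L" using few_heavy by linarith
    qed (use total_miss_nonneg e0 in auto)
    finally show ?thesis .
  qed
  also have "b * k * (\<Sum>v\<in>X. y v * missing v) \<le> b * k * total_miss"
    unfolding total_miss_def using XN ym b_pos k0 by (intro mult_left_mono sum_mono2) auto
  finally have "total_excess \<le> (2 * b * k + 2 * q / a + L / e) * total_miss" by (simp add: algebra_simps)
  also have "\<dots> \<le> (2 * b * k + 2 * q / a + L / e) * total_excess"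
    using b_pos k0 a0 e0 L_nonneg d_pos d_less by (intro mult_left_mono total_miss_le_total_excess) auto
  finally have "1 \<le> 2 * b * k + 2 * q / a + L / e" using total_excess_pos by simp
  then show ?thesis by (simp add: k_def a_def e_def)
qed

end

section \<open>The dichotomy\<close>

text \<open>It remains to choose the thresholds so that the right-hand side of \<open>contraction\<close> is below $1$. Its first
term is nearly $2 b / r = 1 - 2 \epsilon$, and the other terms and all errors cost at most $\epsilon$.\<close>

lemma large_codegree_or_many_heavy_pairs:
  fixes eps :: real
  assumes eps: "0 < eps" "eps < 1/2"
  obtains delta where "0 < delta"
    and "\<And>L :: nat. \<exists>R. \<forall>(V :: 'a set) E y lam u. subeigenvector V E y lam u \<and> R \<le> sqrt (card E) \<longrightarrow>
      (\<exists>v w. {v, w} \<in> E \<and> (1/2 - eps) * sqrt (card E) \<le> codegree E v w) \<or>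
      L < card (heavy_pairs E (delta * sqrt (card E)))"
proof -
  \<comment> \<open>The errors \<open>32 * theta\<close> and \<open>16 * theta\<close> below must not exceed \<open>eps / 2\<close> and \<open>eps / 4\<close>. With
    the square in \<open>delta\<close>, the a priori bound for the total excess, about \<open>2 * delta * r^2\<close>, remains a
    small fraction of \<open>theta * r\<close> after division by \<open>theta * r\<close>.\<close>
  define theta where "theta = eps / 64"
  define delta where "delta = theta\<^sup>2 / 16"
  have th: "0 < theta" "theta < 1/128" using eps by (auto simp: theta_def)
  have dl: "0 < delta" using th by (simp add: delta_def)
  have th2: "theta\<^sup>2 \<le> theta / 128"
    using mult_left_mono[of theta "1/128" theta] th by (simp add: power2_eq_square)
  then have dl_th: "delta \<le> theta / 2048" by (simp add: delta_def)
  have main: "\<exists>R. \<forall>(V :: 'a set) E y lam u. subeigenvector V E y lam u \<and> R \<le> sqrt (card E) \<longrightarrow>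
      (\<exists>v w. {v, w} \<in> E \<and> (1/2 - eps) * sqrt (card E) \<le> codegree E v w) \<or>
      L < card (heavy_pairs E (delta * sqrt (card E)))" for L :: nat
  proof -
    define R where "R = max ((1 + 5 * L + 2 * L / theta) / (theta / 2)) (4 * L / eps\<^sup>2)"
    show ?thesis
    proof (intro exI[of _ R] allI impI)
      fix V :: "'a set" and E y lam u
      assume asm: "subeigenvector V E y lam u \<and> R \<le> sqrt (card E)"
      then interpret subeigenvector V E y lam u by simp
      have "R \<le> r" using asm by (simp add: r_def)
      then have R1: "1 + 5 * L + 2 * L / theta \<le> theta / 2 * r" and R2: "L \<le> eps\<^sup>2 / 4 * r"
        using th eps by (simp_all add: R_def pos_divide_le_eq mult.commute)
      have r0: "0 < r"
      proof (rule ccontr)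
        assume "\<not> 0 < r"
        then have "r = 0" using r_nonneg by simp
        then have "0 \<le> 2 * L / theta" using th by simp
        then show False using R1 \<open>r = 0\<close> by simp
      qed
      show "(\<exists>v w. {v, w} \<in> E \<and> (1/2 - eps) * sqrt (card E) \<le> codegree E v w) \<or>
        L < card (heavy_pairs E (delta * sqrt (card E)))"
      proof (rule ccontr)
        assume "\<not> ?thesis"
        then have small: "\<And>v w. {v, w} \<in> E \<Longrightarrow> codegree E v w < (1/2 - eps) * r"
          and few: "card (heavy_pairs E (delta * r)) \<le> L"
          by (auto simp: r_def not_le not_less)
        interpret small_books V E y lam u "(1/2 - eps) * r" "delta * r" "theta * r" L
          by unfold_locales (use small few r0 dl dl_th th in auto)
        have S1: "total_excess \<le> (2 * delta * r + L) * r"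
        proof -
          have "L * ((1/2 - eps) * r) \<le> L * (1 * r)"
            using eps r0 by (intro mult_left_mono mult_right_mono) auto
          then show ?thesis using total_excess_le by (simp add: algebra_simps)
        qed
        have light1: "light \<le> theta * r / 4 + 4 * L"
        proof -
          have "total_excess / r \<le> 2 * delta * r + L" using S1 r0 by (simp add: pos_divide_le_eq)
          then have "light \<le> 8 * (delta * r) + 4 * L" using light_le_frac by simp
          moreover have "delta * r \<le> theta / 2048 * r" using dl_th r0 by (intro mult_right_mono) auto
          moreover have "0 < theta * r" using th r0 by simp
          ultimately show ?thesis by linarith
        qed
        have frac1: "total_excess / (theta * r - delta * r) \<le> theta * r / 4 + 2 * L / theta"
        proof -
          have pos: "0 < theta / 2 * r" using th r0 by simp
          have "delta * r \<le> theta / 2048 * r" using dl_th r0 by (intro mult_right_mono) auto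
          then have le: "theta / 2 * r \<le> theta * r - delta * r" using pos by simp
          have "total_excess / (theta * r - delta * r) \<le> total_excess / (theta / 2 * r)"
            using le pos total_excess_pos by (intro divide_left_mono) auto
          also have "\<dots> \<le> (2 * delta * r + L) * r / (theta / 2 * r)"
            using S1 pos by (intro divide_right_mono) auto
          also have "\<dots> = theta * r / 4 + 2 * L / theta"
            using th r0 by (simp add: delta_def field_simps power2_eq_square)
          finally show ?thesis .
        qed
        have h1: "err \<le> 2 * (theta * r)"
          using light1 frac1 R1 unfolding err_def by (simp add: algebra_simps)
        have thr: "theta * r < r / 128" using th r0 by simp
        have dlr: "delta * r \<le> theta * r / 2048" using mult_right_mono[OF dl_th, of r] r0 by simp
        have eth: "eps * r = 64 * (theta * r)" by (simp add: theta_def)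
        have thr0: "0 < theta * r" using th r0 by simp
        have hr: "err \<le> r / 8" using h1 thr r0 by linarith
        have b2: "2 * ((1/2 - eps) * r) = r - 2 * (eps * r)" by (simp add: algebra_simps)
        have bh: "2 * ((1/2 - eps) * r) + 2 * err < r"
          unfolding b2 using h1 thr0 eth by linarith
        have a: "r / 4 \<le> card Wmain"
          by (rule card_Wmain_ge[OF hr]) (use bh in linarith)
        have hW: "err < card Wmain" and dW: "delta * r < card Wmain"
          using a h1 thr dlr r0 thr0 by linarith+
        define c where "c = real (card Wmain)"
        have c: "r / 4 \<le> c" using a by (simp add: c_def)
        have t1: "2 * ((1/2 - eps) * r) * (c + err) / (r * (c - err)) \<le> 1 - 2 * eps + eps / 2"
        proof -
          have hc: "err \<le> 8 * (theta * c)"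
          proof -
            have "theta * r \<le> theta * (4 * c)" using c th by (intro mult_left_mono) auto
            then show ?thesis using h1 by linarith
          qed
          have "c + err \<le> (1 + 32 * theta) * (c - err)"
          proof -
            have "theta * err \<le> 1/128 * err" using th err_nonneg by (intro mult_right_mono) auto
            then have "err * (2 + 32 * theta) \<le> 4 * err" using err_nonneg by (simp add: algebra_simps)
            also have "\<dots> \<le> 32 * (theta * c)" using hc by linarith
            finally show ?thesis by (simp add: algebra_simps)
          qed
          moreover have ch: "0 < c - err" using hW by (simp add: c_def)
          ultimately have "(c + err) / (c - err) \<le> 1 + 32 * theta" by (simp add: pos_divide_le_eq)
          then have "(1 - 2 * eps) * ((c + err) / (c - err)) \<le> (1 - 2 * eps) * (1 + 32 * theta)"
            using eps by (intro mult_left_mono) auto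
          also have "\<dots> \<le> 1 - 2 * eps + eps / 2"
            using eps by (simp add: theta_def algebra_simps)
          also have "(1 - 2 * eps) * ((c + err) / (c - err)) = 2 * ((1/2 - eps) * r) * (c + err) / (r * (c - err))"
          proof -
            have "2 * ((1/2 - eps) * r) * (c + err) = r * ((1 - 2 * eps) * (c + err))"
              by (simp add: algebra_simps)
            moreover have "r \<noteq> 0" using r0 by simp
            ultimately show ?thesis
              by (simp only: mult_divide_mult_cancel_left times_divide_eq_right not_False_eq_True)
          qed
          finally show ?thesis .
        qed
        have t2: "2 * (theta * r) / (c - delta * r) \<le> eps / 4"
        proof -
          have "r / 8 \<le> c - delta * r" using c dlr thr r0 by linarith
          then have "2 * (theta * r) / (c - delta * r) \<le> 2 * (theta * r) / (r / 8)"
            using r0 thr0 by (intro divide_left_mono) auto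
          also have "\<dots> = eps / 4" using r0 by (simp add: theta_def)
          finally show ?thesis .
        qed
        have t3: "L / (r - 2 * ((1/2 - eps) * r) - 2 * err) \<le> eps / 4"
        proof -
          have er: "0 < eps * r" using eps r0 by simp
          have "eps * r \<le> r - 2 * ((1/2 - eps) * r) - 2 * err"
            unfolding b2 using h1 eth thr0 by linarith
          then have "L / (r - 2 * ((1/2 - eps) * r) - 2 * err) \<le> L / (eps * r)"
            using er by (intro divide_left_mono) auto
          also have "\<dots> \<le> eps / 4"
            using R2 er by (simp add: pos_divide_le_eq power2_eq_square algebra_simps)
          finally show ?thesis .
        qed
        show False
          using contraction[OF bh hW dW] t1 t2 t3 eps unfolding c_def by linarith
      qed
    qed
  qed
  show ?thesis by (rule that[OF dl main])
qed

section \<open>From the largest eigenvalue to a subeigenvector\<close>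

lemma adjacency_mult_vec:
  assumes "simple_graph {0..<n} E" "v \<in> carrier_vec n" "i < n"
  shows "(adjacency_matrix n E *\<^sub>v v) $ i = (\<Sum>j\<in>nbrs E i. v $ j)"
proof -
  have "(adjacency_matrix n E *\<^sub>v v) $ i = (\<Sum>j\<in>{0..<n}. if {i, j} \<in> E then v $ j else 0)"
    using assms(2,3) by (auto simp: adjacency_matrix_def scalar_prod_def intro!: sum.cong)
  also have "\<dots> = (\<Sum>j\<in>{0..<n} \<inter> nbrs E i. v $ j)"
    by (subst sum.inter_restrict) (auto simp: nbrs_def)
  also have "{0..<n} \<inter> nbrs E i = nbrs E i" using nbrs_subset[OF assms(1)] by auto
  finally show ?thesis .
qed

text \<open>Only a nonempty real spectrum makes the largest eigenvalue an eigenvalue. A complex eigenvalue $\mu$ with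
eigenvector $w$ exists, and $\mu$ is real because $w^* A w = \mu \|w\|^2$ is; then the real and the
imaginary part of $w$ satisfy the eigenvalue equation as well, and one of them is not zero.\<close>

lemma real_symmetric_spectrum_nonempty:
  fixes A :: "real mat"
  assumes A: "A \<in> carrier_mat n n" and n: "0 < n"
    and sym: "\<And>i j. i < n \<Longrightarrow> j < n \<Longrightarrow> A $$ (i, j) = A $$ (j, i)"
  shows "spectrum A \<noteq> {}"
proof -
  define C where "C = map_mat complex_of_real A"
  have C: "C \<in> carrier_mat n n" using A by (simp add: C_def)
  obtain mu w where ew: "eigenvector C w mu"
    using spectrum_non_empty[OF C n] by (auto simp: spectrum_def eigenvalue_def)
  then have w: "w \<in> carrier_vec n" and w0: "w \<noteq> 0\<^sub>v n" and Cw: "C *\<^sub>v w = mu \<cdot>\<^sub>v w"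
    using C by (auto simp: eigenvector_def)
  have row: "(\<Sum>j<n. complex_of_real (A $$ (i, j)) * w $ j) = mu * w $ i" if "i < n" for i
  proof -
    have "(C *\<^sub>v w) $ i = (\<Sum>j<n. complex_of_real (A $$ (i, j)) * w $ j)"
      using that A w by (auto simp: C_def scalar_prod_def atLeast0LessThan intro!: sum.cong)
    then show ?thesis using Cw that w by simp
  qed
  define Q where "Q = (\<Sum>i<n. \<Sum>j<n. cnj (w $ i) * (complex_of_real (A $$ (i, j)) * w $ j))"
  define nn where "nn = (\<Sum>i<n. (cmod (w $ i))\<^sup>2)"
  have Q: "Q = mu * complex_of_real nn"
  proof -
    have "Q = (\<Sum>i<n. cnj (w $ i) * (mu * w $ i))"
      unfolding Q_def by (intro sum.cong refl) (simp add: row flip: sum_distrib_left)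
    also have "\<dots> = (\<Sum>i<n. mu * complex_of_real ((cmod (w $ i))\<^sup>2))"
      by (intro sum.cong refl) (simp add: complex_norm_square[symmetric] mult.left_commute mult.commute[of "cnj _"])
    finally show ?thesis by (simp add: nn_def sum_distrib_left)
  qed
  have "cnj Q = (\<Sum>i<n. \<Sum>j<n. w $ i * (complex_of_real (A $$ (i, j)) * cnj (w $ j)))"
    by (simp add: Q_def)
  also have "\<dots> = (\<Sum>j<n. \<Sum>i<n. w $ i * (complex_of_real (A $$ (i, j)) * cnj (w $ j)))"
    by (rule sum.swap)
  also have "\<dots> = Q" unfolding Q_def
    by (intro sum.cong refl) (simp add: sym mult_ac)
  finally have cQ: "cnj Q = Q" .
  obtain i where i: "i < n" "w $ i \<noteq> 0" using w w0 by (auto simp: vec_eq_iff)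
  have "0 < (cmod (w $ i))\<^sup>2" using i by simp
  also have "\<dots> \<le> nn" unfolding nn_def using i by (intro member_le_sum) auto
  finally have "nn \<noteq> 0" by simp
  then have "cnj mu = mu" using cQ unfolding Q by simp
  then have Im0: "Im mu = 0" by (metis Reals_cnj_iff complex_is_Real_iff)
  have part: "Re mu \<in> spectrum A"
    if x: "\<And>j. j < n \<Longrightarrow> (\<Sum>k<n. A $$ (j, k) * x k) = Re mu * x j" and "x i \<noteq> 0"
    for x :: "nat \<Rightarrow> real"
  proof -
    have "eigenvector A (vec n x) (Re mu)"
    proof -
      have "vec n x \<noteq> 0\<^sub>v n" using i that(2) by (metis index_vec index_zero_vec(1))
      moreover have "A *\<^sub>v vec n x = Re mu \<cdot>\<^sub>v vec n x"
        using A x by (intro eq_vecI) (auto simp: scalar_prod_def atLeast0LessThan)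
      ultimately show ?thesis using A by (simp add: eigenvector_def)
    qed
    then show ?thesis by (auto simp: spectrum_def eigenvalue_def)
  qed
  have "Re (w $ i) \<noteq> 0 \<or> Im (w $ i) \<noteq> 0" using i complex_eq_iff by auto
  then show ?thesis
  proof
    assume "Re (w $ i) \<noteq> 0"
    then have "Re mu \<in> spectrum A"
    proof (rule part[rotated])
      fix j assume "j < n"
      from arg_cong[OF row[OF this], of Re]
      show "(\<Sum>k<n. A $$ (j, k) * Re (w $ k)) = Re mu * Re (w $ j)" by (simp add: Im0)
    qed
    then show ?thesis by auto
  next
    assume "Im (w $ i) \<noteq> 0"
    then have "Re mu \<in> spectrum A"
    proof (rule part[rotated])
      fix j assume "j < n"
      from arg_cong[OF row[OF this], of Im]
      show "(\<Sum>k<n. A $$ (j, k) * Im (w $ k)) = Re mu * Im (w $ j)" by (simp add: Im0)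
    qed
    then show ?thesis by auto
  qed
qed

text \<open>By the triangle inequality $\lambda |v_i| = |\sum_{j \sim i} v_j| \le \sum_{j \sim i} |v_j|$.\<close>

lemma subeigenvector_of_graph_lambda:
  assumes g: "simple_graph {0..<n} E" and E: "E \<noteq> {}" and gt: "sqrt (card E) < graph_lambda n E"
  shows "\<exists>y u. subeigenvector {0..<n} E y (graph_lambda n E) u"
proof -
  define A where "A = adjacency_matrix n E"
  define lam where "lam = graph_lambda n E"
  have A: "A \<in> carrier_mat n n" by (simp add: A_def adjacency_matrix_def)
  have n: "0 < n"
  proof (rule ccontr)
    assume "\<not> 0 < n"
    then show False using g E by (fastforce simp: simple_graph_def)
  qed
  have "spectrum A \<noteq> {}"
    by (rule real_symmetric_spectrum_nonempty[OF A n]) (simp add: A_def adjacency_matrix_def insert_commute)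
  then have "lam \<in> spectrum A"
    using Max_in[OF card_finite_spectrum(1)[OF A]] by (simp add: lam_def graph_lambda_def A_def)
  then obtain v where "eigenvector A v lam" by (auto simp: spectrum_def eigenvalue_def)
  then have v: "v \<in> carrier_vec n" and v0: "v \<noteq> 0\<^sub>v n" and Av: "A *\<^sub>v v = lam \<cdot>\<^sub>v v"
    using A by (auto simp: eigenvector_def)
  define mx where "mx = Max ((\<lambda>i. \<bar>v $ i\<bar>) ` {0..<n})"
  have "mx \<in> (\<lambda>i. \<bar>v $ i\<bar>) ` {0..<n}" unfolding mx_def using n by (intro Max_in) auto
  then obtain u where u: "u < n" "mx = \<bar>v $ u\<bar>" by auto
  have le: "\<bar>v $ i\<bar> \<le> mx" if "i < n" for i unfolding mx_def using that by (intro Max_ge) auto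
  obtain i where i: "i < n" "v $ i \<noteq> 0" using v v0 by (auto simp: vec_eq_iff)
  then have mx: "0 < mx" using le[of i] by simp
  have row: "lam * v $ i = (\<Sum>j\<in>nbrs E i. v $ j)" if "i < n" for i
    using adjacency_mult_vec[OF g v that] Av v that by (simp add: A_def)
  have "0 \<le> sqrt (card E)" by simp
  then have lam0: "0 \<le> lam" using gt unfolding lam_def by linarith
  have "subeigenvector {0..<n} E (\<lambda>i. \<bar>v $ i\<bar> / mx) lam u"
  proof
    show "lam * (\<bar>v $ i\<bar> / mx) \<le> (\<Sum>i\<in>nbrs E i. \<bar>v $ i\<bar> / mx)" if "i \<in> {0..<n}" for i
    proof -
      have "lam * \<bar>v $ i\<bar> = \<bar>\<Sum>j\<in>nbrs E i. v $ j\<bar>"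
        using row[of i] that lam0 by (metis abs_mult abs_of_nonneg atLeastLessThan_iff)
      also have "\<dots> \<le> (\<Sum>j\<in>nbrs E i. \<bar>v $ j\<bar>)" by (rule sum_abs)
      finally show ?thesis using mx by (simp add: divide_right_mono flip: sum_divide_distrib)
    qed
  qed (use g u le mx gt in \<open>auto simp: lam_def\<close>)
  then show ?thesis unfolding lam_def by blast
qed

section \<open>Counting books\<close>

definition books :: "nat \<Rightarrow> 'a set \<Rightarrow> 'a set set \<Rightarrow> ('a set \<times> 'a set set) set" where
  "books t V E = {(W, F). W \<subseteq> V \<and> F \<subseteq> E \<and> is_book t W F}"

definition book_on :: "'a \<Rightarrow> 'a \<Rightarrow> 'a set \<Rightarrow> 'a set \<times> 'a set set" where
  "book_on v w S = ({v, w} \<union> S, {{v, w}} \<union> (\<lambda>x. {v, x}) ` S \<union> (\<lambda>x. {w, x}) ` S)"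

definition pages :: "nat \<Rightarrow> 'a set set \<Rightarrow> 'a \<Rightarrow> 'a \<Rightarrow> 'a set set" where
  "pages t E v w = {S. S \<subseteq> nbrs E v \<inter> nbrs E w \<and> card S = t}"

context
  fixes V :: "'a set" and E :: "'a set set" and t :: nat
  assumes g: "simple_graph V E"
begin

lemma finite_books: "finite (books t V E)"
proof -
  have V: "finite V" using g by (simp add: simple_graph_def)
  then have E: "finite E" using g by (auto simp: simple_graph_def intro: finite_subset[of E "Pow V"])
  have "books t V E \<subseteq> Pow V \<times> Pow E" by (auto simp: books_def)
  then show ?thesis by (rule finite_subset) (use V E in simp)
qed

lemma card_pages: "card (pages t E v w) = codegree E v w choose t"
  unfolding pages_def codegree_def by (rule n_subsets) (simp add: finite_nbrs[OF g])

lemma pages_avoid_spine: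
  assumes "S \<in> pages t E v w"
  shows "v \<notin> S" "w \<notin> S"
  using assms nbrs_irrefl[OF g] by (auto simp: pages_def)

lemma pages_eq:
  assumes "S \<in> pages t E v w"
  shows "S = fst (book_on v w S) - {v, w}"
  using pages_avoid_spine[OF assms] by (auto simp: book_on_def)

lemma book_on_in_books:
  assumes vw: "{v, w} \<in> E" and S: "S \<in> pages t E v w"
  shows "book_on v w S \<in> books t V E"
proof -
  have "v \<noteq> w" using nbrs_irrefl[OF g, of v] vw by (auto simp: nbrs_def)
  moreover have "finite S" using S finite_nbrs[OF g]
    by (auto simp: pages_def intro: finite_subset)
  ultimately have "is_book t (fst (book_on v w S)) (snd (book_on v w S))"
    unfolding is_book_def book_on_def using pages_avoid_spine[OF S] S
    by (intro exI[of _ v] exI[of _ w] exI[of _ S]) (simp add: pages_def)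
  moreover have "fst (book_on v w S) \<subseteq> V"
    using S vw g nbrs_subset[OF g, of v] by (auto simp: book_on_def pages_def simple_graph_def)
  moreover have "snd (book_on v w S) \<subseteq> E"
    using S vw by (auto simp: book_on_def pages_def nbrs_def)
  ultimately show ?thesis by (auto simp: books_def split: prod.split)
qed

lemma choose_codegree_le_book_count:
  assumes "{v, w} \<in> E"
  shows "codegree E v w choose t \<le> book_count t V E"
proof -
  have "inj_on (book_on v w) (pages t E v w)"
    using pages_eq by (intro inj_onI) metis
  then have "card (pages t E v w) \<le> card (books t V E)"
    using book_on_in_books[OF assms] by (intro card_inj_on_le[OF _ _ finite_books]) auto
  then show ?thesis by (simp add: card_pages book_count_def books_def)
qed

text \<open>A copy $(W, F)$ may arise from several spines, for instance from all three edges of a triangle. But the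
spine determines the pages as the rest of $W$, so a copy arises from at most $|W|^2 = (t + 2)^2$ ordered
pairs.\<close>

lemma sum_choose_codegree_le_book_count:
  assumes H: "H \<subseteq> {(v, w). {v, w} \<in> E}" and fH: "finite H"
  shows "(\<Sum>(v, w)\<in>H. codegree E v w choose t) \<le> (t + 2)\<^sup>2 * book_count t V E"
proof -
  define T where "T = (SIGMA p:H. pages t E (fst p) (snd p))"
  define U where "U = (SIGMA b:books t V E. fst b \<times> fst b)"
  define f where "f = (\<lambda>(p, S). (book_on (fst p) (snd p) S, p :: 'a \<times> 'a))"
  have fin_pages: "finite (pages t E v w)" for v w
    unfolding pages_def using finite_nbrs[OF g] by simp
  have cW: "finite W \<and> card W = t + 2" if "(W, F) \<in> books t V E" for W F
    using that by (auto simp: books_def is_book_def)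
  have fU: "finite U" unfolding U_def using cW by (intro finite_SigmaI finite_books) auto
  have "inj_on f T"
  proof (rule inj_onI)
    fix a b assume a: "a \<in> T" and b: "b \<in> T" and eq: "f a = f b"
    obtain v w S where as: "a = ((v, w), S)" by (cases a) auto
    obtain v' w' S' where bs: "b = ((v', w'), S')" by (cases b) auto
    have vw: "v' = v" "w' = w" and bo: "book_on v w S = book_on v w S'"
      using eq by (auto simp: f_def as bs)
    have "S \<in> pages t E v w" "S' \<in> pages t E v w" using a b by (auto simp: T_def as bs vw)
    then have "S = S'" using bo pages_eq by metis
    then show "a = b" by (simp add: as bs vw)
  qed
  moreover have "f ` T \<subseteq> U"
  proof
    fix z assume "z \<in> f ` T"
    then obtain v w S where z: "z = (book_on v w S, (v, w))" and vw: "(v, w) \<in> H" and S: "S \<in> pages t E v w"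
      by (auto simp: f_def T_def)
    have "book_on v w S \<in> books t V E" using book_on_in_books[OF _ S] vw H by auto
    then show "z \<in> U" by (auto simp: U_def z book_on_def)
  qed
  ultimately have "card T \<le> card U" using fU by (rule card_inj_on_le)
  also have "card U = (\<Sum>b\<in>books t V E. card (fst b \<times> fst b))"
    unfolding U_def using cW by (intro card_SigmaI finite_books) auto
  also have "\<dots> = (\<Sum>b\<in>books t V E. (t + 2)\<^sup>2)"
    using cW by (intro sum.cong) (auto simp: card_cartesian_product power2_eq_square)
  also have "\<dots> = (t + 2)\<^sup>2 * book_count t V E" by (simp add: book_count_def books_def)
  finally have "card T \<le> (t + 2)\<^sup>2 * book_count t V E" .
  moreover have "card T = (\<Sum>(v, w)\<in>H. codegree E v w choose t)"
    unfolding T_def using fH fin_pages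
    by (subst card_SigmaI) (auto simp: card_pages case_prod_unfold)
  ultimately show ?thesis by simp
qed

end

lemma choose_ge_power:
  fixes x :: real
  assumes "real t \<le> x" "x \<le> real k"
  shows "(x - real t) ^ t / fact t \<le> real (k choose t)"
proof -
  have "(x - real t) ^ t = (\<Prod>i<t. x - real t)" by simp
  also have "\<dots> \<le> (\<Prod>i<t. real k - real i)" using assms by (intro prod_mono) auto
  finally have "(x - real t) ^ t / fact t \<le> (\<Prod>i<t. real k - real i) / fact t"
    by (intro divide_right_mono) auto
  also have "\<dots> = real (k choose t)" by (simp add: binomial_gbinomial gbinomial_prod_rev atLeast0LessThan)
  finally show ?thesis .
qed

section \<open>The asymptotic lower bound\<close>

text \<open>The parameter \<open>eps\<close> is used twice: once for the codegree $(1/2 - \epsilon) r$ and once to absorb the loss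
of \<open>t\<close> in \<open>choose_ge_power\<close>. The number \<open>L\<close> of heavy pairs is chosen so that \<open>L\<close> times
$(\delta r / 2)^t / t!$ outweighs the multiplicity $(t + 2)^2$ with which copies are counted.\<close>

lemma eventually_book_count_ge:
  fixes t :: nat and e :: real
  assumes e: "0 < e"
  shows "\<exists>m0. \<forall>n (E :: nat set set). simple_graph {0..<n} E \<longrightarrow> m0 \<le> card E \<longrightarrow>
    sqrt (real (card E)) < graph_lambda n E \<longrightarrow>
    (1 / (fact t * 2 ^ t) - e) * real (card E) powr (real t / 2) \<le> book_count t {0..<n} E"
proof -
  define c :: real where "c = 1 / (fact t * 2 ^ t)"
  have "\<exists>eps>0. eps < 1/2 \<and> (1/2 :: real) ^ t - e * fact t < (1/2 - 2 * eps) ^ t \<and> 2 * eps < 1/2"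
  proof -
    have "((\<lambda>x. (1/2 - 2 * x) ^ t) \<longlongrightarrow> (1/2 - 2 * 0 :: real) ^ t) (at_right 0)"
      by (intro tendsto_intros)
    then have "eventually (\<lambda>x. (1/2 :: real) ^ t - e * fact t < (1/2 - 2 * x) ^ t) (at_right 0)"
      by (rule order_tendstoD(1)) (use e in simp)
    moreover have "eventually (\<lambda>x :: real. x \<in> {0<..<1/4}) (at_right 0)"
      by (rule eventually_at_right_real) simp
    ultimately have "eventually (\<lambda>x. (1/2 :: real) ^ t - e * fact t < (1/2 - 2 * x) ^ t \<and> x \<in> {0<..<1/4})
        (at_right 0)" by (rule eventually_conj)
    then obtain x :: real where "(1/2 :: real) ^ t - e * fact t < (1/2 - 2 * x) ^ t" "x \<in> {0<..<1/4}"
      using eventually_happens'[OF trivial_limit_at_right_real] by blast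
    then show ?thesis by (intro exI[of _ x]) auto
  qed
  then obtain eps where eps: "0 < eps" "eps < 1/2" "2 * eps < 1/2"
    and pw: "(1/2 :: real) ^ t - e * fact t < (1/2 - 2 * eps) ^ t" by auto
  obtain delta where dl: "0 < delta" and dich: "\<And>L :: nat. \<exists>R. \<forall>(V :: nat set) E y lam u.
      subeigenvector V E y lam u \<and> R \<le> sqrt (card E) \<longrightarrow>
      (\<exists>v w. {v, w} \<in> E \<and> (1/2 - eps) * sqrt (card E) \<le> codegree E v w) \<or>
      L < card (heavy_pairs E (delta * sqrt (card E)))"
    using large_codegree_or_many_heavy_pairs[OF eps(1,2)] by metis
  define L where "L = nat \<lceil>(real t + 2)\<^sup>2 / delta ^ t\<rceil>"
  have L: "(real t + 2)\<^sup>2 \<le> real L * delta ^ t"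
  proof -
    have "(real t + 2)\<^sup>2 / delta ^ t \<le> real L" unfolding L_def by (rule real_nat_ceiling_ge)
    then show ?thesis using dl by (simp add: pos_divide_le_eq)
  qed
  obtain R where R: "\<forall>(V :: nat set) E y lam u. subeigenvector V E y lam u \<and> R \<le> sqrt (card E) \<longrightarrow>
      (\<exists>v w. {v, w} \<in> E \<and> (1/2 - eps) * sqrt (card E) \<le> codegree E v w) \<or>
      L < card (heavy_pairs E (delta * sqrt (card E)))"
    using dich[of L] by (rule exE)
  define R' where "R' = Max {R, 1, real t / eps, 2 * real t / delta}"
  show ?thesis
  proof (intro exI[of _ "nat \<lceil>R'\<^sup>2\<rceil>"] allI impI)
    fix n and E :: "nat set set"
    assume g: "simple_graph {0..<n} E" and m: "nat \<lceil>R'\<^sup>2\<rceil> \<le> card E"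
      and lam: "sqrt (real (card E)) < graph_lambda n E"
    define r where "r = sqrt (real (card E))"
    have "R'\<^sup>2 \<le> real (card E)" using m real_nat_ceiling_ge[of "R'\<^sup>2"] by linarith
    then have "R' \<le> r" unfolding r_def by (rule real_le_rsqrt)
    then have rR: "R \<le> r" and r1: "1 \<le> r" and "real t / eps \<le> r" and "2 * real t / delta \<le> r"
      by (auto simp: R'_def)
    then have rt: "real t \<le> eps * r" "2 * real t \<le> delta * r"
      using eps dl by (simp_all add: pos_divide_le_eq mult.commute)
    have r0: "0 < r" using r1 by simp
    have powr: "real (card E) powr (real t / 2) = r ^ t"
    proof -
      have "r ^ t = r powr real t" using r0 by (simp add: powr_realpow)
      also have "\<dots> = (real (card E) powr (1/2)) powr real t" by (simp add: r_def powr_half_sqrt)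
      also have "\<dots> = real (card E) powr (real t / 2)" by (simp add: powr_powr)
      finally show ?thesis by simp
    qed
    have "E \<noteq> {}" using r0 by (auto simp: r_def)
    then obtain y u where sub: "subeigenvector {0..<n} E y (graph_lambda n E) u"
      using subeigenvector_of_graph_lambda[OF g _ lam] by auto
    have "(\<exists>v w. {v, w} \<in> E \<and> (1/2 - eps) * r \<le> codegree E v w) \<or>
        L < card (heavy_pairs E (delta * r))"
      using R[rule_format, of "{0..<n}" E y "graph_lambda n E" u] sub rR by (simp add: r_def)
    then consider v w where "{v, w} \<in> E" "(1/2 - eps) * r \<le> codegree E v w"
      | "L < card (heavy_pairs E (delta * r))" by blast
    then have "(c - e) * r ^ t \<le> book_count t {0..<n} E"
    proof cases
      case (1 v w)
      have "(c - e) * r ^ t = ((1/2) ^ t - e * fact t) * r ^ t / fact t"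
        by (simp add: c_def field_simps power_one_over)
      also have "\<dots> \<le> (1/2 - 2 * eps) ^ t * r ^ t / fact t"
        using pw r0 by (intro divide_right_mono mult_right_mono) auto
      also have "\<dots> = ((1/2 - 2 * eps) * r) ^ t / fact t" by (simp add: power_mult_distrib)
      also have "\<dots> \<le> ((1/2 - eps) * r - real t) ^ t / fact t"
        using rt eps r0 by (intro divide_right_mono power_mono) (auto simp: algebra_simps)
      also have "\<dots> \<le> real (codegree E v w choose t)"
      proof (rule choose_ge_power)
        have "0 \<le> (1/2 - 2 * eps) * r" using eps r0 by simp
        then show "real t \<le> (1/2 - eps) * r" using rt by (simp add: algebra_simps)
      qed (use 1 in simp)
      also have "\<dots> \<le> book_count t {0..<n} E"
        using choose_codegree_le_book_count[OF g 1(1), of t] by simp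
      finally show ?thesis .
    next
      case 2
      define H where "H = heavy_pairs E (delta * r)"
      have H: "H \<subseteq> {(v, w). {v, w} \<in> E}" by (auto simp: H_def heavy_pairs_def)
      have fH: "finite H" unfolding H_def by (rule finite_heavy_pairs[OF g])
      have "(real t + 2)\<^sup>2 * (c * r ^ t) \<le> real L * delta ^ t * (c * r ^ t)"
        using L r0 by (intro mult_right_mono) (auto simp: c_def)
      also have "\<dots> = real L * ((delta * r / 2) ^ t / fact t)"
        by (simp add: c_def power_mult_distrib power_divide mult_ac)
      also have "\<dots> \<le> real (card H) * ((delta * r / 2) ^ t / fact t)"
        using 2 dl r0 by (intro mult_right_mono) (auto simp: H_def)
      also have "\<dots> = (\<Sum>p\<in>H. (delta * r / 2) ^ t / fact t)" by simp
      also have "\<dots> \<le> (\<Sum>(v, w)\<in>H. real (codegree E v w choose t))"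
      proof (rule sum_mono, clarify)
        fix v w assume "(v, w) \<in> H"
        then have cd: "delta * r \<le> codegree E v w" by (simp add: H_def heavy_pairs_def)
        have "(delta * r / 2) ^ t / fact t \<le> (delta * r - real t) ^ t / fact t"
          using rt dl r0 by (intro divide_right_mono power_mono) auto
        also have "\<dots> \<le> real (codegree E v w choose t)"
          using rt cd by (intro choose_ge_power) auto
        finally show "(delta * r / 2) ^ t / fact t \<le> real (codegree E v w choose t)" .
      qed
      also have "\<dots> = real (\<Sum>(v, w)\<in>H. codegree E v w choose t)"
        by (simp add: case_prod_unfold)
      also have "\<dots> \<le> real ((t + 2)\<^sup>2 * book_count t {0..<n} E)"
        using sum_choose_codegree_le_book_count[OF g H fH, of t] by (simp only: of_nat_le_iff)
      also have "\<dots> = (real t + 2)\<^sup>2 * real (book_count t {0..<n} E)" by simp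
      finally have "c * r ^ t \<le> real (book_count t {0..<n} E)"
        by (rule mult_left_le_imp_le) (simp add: add_nonneg_pos)
      moreover have "(c - e) * r ^ t \<le> c * r ^ t" using e r0 by (intro mult_right_mono) auto
      ultimately show ?thesis by linarith
    qed
    then show "(1 / (fact t * 2 ^ t) - e) * real (card E) powr (real t / 2) \<le> book_count t {0..<n} E"
      by (simp add: powr c_def)
  qed
qed

text \<open>The error at \<open>m\<close> is the worst relative shortfall of a graph with \<open>m\<close> edges. Adding $0$ to the set under
the supremum covers the case that there is no such graph.\<close>

theorem theorem4p11:
  fixes t :: nat
  assumes "t \<ge> 1"
  shows "\<exists>\<epsilon> :: nat \<Rightarrow> real. \<epsilon> \<longlonglongrightarrow> 0 \<and>
    (\<forall>(n :: nat) (E :: nat set set).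
       simple_graph {0..<n} E \<and> graph_lambda n E > sqrt (real (card E)) \<longrightarrow>
       real (book_count t {0..<n} E)
         \<ge> (1 / (fact t * 2 ^ t) - \<epsilon> (card E)) * real (card E) powr (real t / 2))"
proof -
  define c :: real where "c = 1 / (fact t * 2 ^ t)"
  define D where "D = (\<lambda>m. insert 0 {c - real (book_count t {0..<n} E) / real m powr (real t / 2) | n E.
    simple_graph {0..<n} E \<and> sqrt (real (card E)) < graph_lambda n E \<and> card E = m})"
  define eps where "eps = (\<lambda>m. Sup (D m))"
  have bdd: "bdd_above (D m)" for m
    by (rule bdd_aboveI[of _ c]) (auto simp: D_def c_def)
  have nonneg: "0 \<le> eps m" for m
    unfolding eps_def by (rule cSup_upper[OF _ bdd]) (simp add: D_def)
  have lim: "eps \<longlonglongrightarrow> 0"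
  proof (rule LIMSEQ_I)
    fix e :: real assume e: "0 < e"
    then have half: "0 < e / 2" by simp
    obtain m0 where m0: "\<forall>n (E :: nat set set). simple_graph {0..<n} E \<longrightarrow> m0 \<le> card E \<longrightarrow>
      sqrt (real (card E)) < graph_lambda n E \<longrightarrow>
      (1 / (fact t * 2 ^ t) - e / 2) * real (card E) powr (real t / 2) \<le> book_count t {0..<n} E"
      using eventually_book_count_ge[OF half] by (rule exE)
    have "norm (eps m - 0) < e" if m: "max 1 m0 \<le> m" for m
    proof -
      have "eps m \<le> e / 2" unfolding eps_def
      proof (rule cSup_least)
        fix x assume "x \<in> D m"
        then consider "x = 0" | n E where "x = c - real (book_count t {0..<n} E) / real m powr (real t / 2)"
          "simple_graph {0..<n} E" "sqrt (real (card E)) < graph_lambda n E" "card E = m"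
          unfolding D_def by auto
        then show "x \<le> e / 2"
        proof cases
          case 2
          have "(c - e / 2) * real m powr (real t / 2) \<le> book_count t {0..<n} E"
            using m0[rule_format, of n E] 2 m by (simp add: c_def)
          moreover have "0 < real m powr (real t / 2)" using m by simp
          ultimately have "c - e / 2 \<le> book_count t {0..<n} E / real m powr (real t / 2)"
            by (simp add: pos_le_divide_eq)
          then show ?thesis using 2(1) by linarith
        qed (use e in simp)
      qed (simp add: D_def)
      then show ?thesis using nonneg[of m] e by simp
    qed
    then show "\<exists>no. \<forall>m\<ge>no. norm (eps m - 0) < e" by blast
  qed
  have "(c - eps (card E)) * real (card E) powr (real t / 2) \<le> book_count t {0..<n} E"
    if "simple_graph {0..<n} E" "sqrt (real (card E)) < graph_lambda n E" for n E
  proof (cases "card E = 0")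
    case False
    define p where "p = real (card E) powr (real t / 2)"
    have p: "0 < p" using False by (simp add: p_def)
    have "c - real (book_count t {0..<n} E) / p \<in> D (card E)"
      using that unfolding D_def p_def by blast
    then have "c - real (book_count t {0..<n} E) / p \<le> eps (card E)"
      unfolding eps_def by (rule cSup_upper[OF _ bdd])
    then have "c - eps (card E) \<le> real (book_count t {0..<n} E) / p" by simp
    then show ?thesis using p by (simp add: pos_le_divide_eq p_def)
  qed simp
  with lim show ?thesis unfolding c_def by blast
qed

end
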